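(* Let $\varphi$ be an LTL formula of length $n$, and let $B_{\mathbf{GF}}$, $B_{\mathbf{FG}}$ be as defined in the context. Then $$\varphi \equiv \bigvee_{\substack{M \subseteq B_{\mathbf{GF}} \\ N \subseteq B_{\mathbf{FG}}}} \Big( \varphi\langle M\rangle_{\Sigma_2} \wedge \bigwedge_{\mathbf{F}\mathbf{G}\psi \in N} \mathbf{F}\mathbf{G}\big(\psi\langle M\rangle_{\nu}\big) \wedge \bigwedge_{\mathbf{G}\mathbf{F}\psi \in M} \mathbf{G}\mathbf{F}\big(\psi\langle N\rangle_{\mu}\big) \Big).$$ Moreover, the right-hand side formula belongs to $\Delta_2$ and has length $2^{O(n)}$.
   Context: LTL formulas over a finite set $Ap$ of atomic propositions are in negation normal form: $\varphi ::= \mathbf{tt}\mid\mathbf{ff}\mid a\mid\overline{a}\mid\varphi\wedge\varphi\mid\varphi\vee\varphi\mid\mathbf{X}\varphi\mid\varphi\,\mathbf{U}\,\varphi\mid\varphi\,\mathbf{W}\,\varphi\mid\varphi\,\mathbf{R}\,\varphi\mid\varphi\,\mathbf{M}\,\varphi$ with $a\in Ap$, interpreted on infinite words $w$ over $2^{Ap}$; $w_i$ is the suffix of $w$ starting at position $i$. $w\models a$ iff $a\in w[0]$; $w\models\overline a$ iff $a\notin w[0]$; $\wedge,\vee$ as usual; $w\models\mathbf X\varphi$ iff $w_1\models\varphi$; $w\models\varphi\mathbf U\psi$ iff $\exists k.\,w_k\models\psi\wedge\forall j<k.\,w_j\models\varphi$; $w\models\varphi\mathbf M\psi$ iff $\exists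 k.\,w_k\models\varphi\wedge\forall j\le k.\,w_j\models\psi$; $w\models\varphi\mathbf R\psi$ iff $\forall k.\,w_k\models\psi$ or $w\models\varphi\mathbf M\psi$; $w\models\varphi\mathbf W\psi$ iff $\forall k.\,w_k\models\varphi$ or $w\models\varphi\mathbf U\psi$. $\mathbf F\varphi:=\mathbf{tt}\,\mathbf U\,\varphi$, $\mathbf G\varphi:=\varphi\,\mathbf W\,\mathbf{ff}$. $\varphi\equiv\psi$ means both have the same set of models. The length of a formula is the number of nodes of its syntax tree; $sf(\varphi)$ is the set of subformulas of $\varphi$ (including $\varphi$). Hierarchy: $\Sigma_0=\Pi_0=\Delta_0$ is the least set containing $\mathbf{tt},\mathbf{ff}$, all $a,\overline a$, closed under $\wedge,\vee$; $\Sigma_{i+1}$ is the least set containing $\Pi_i$ closed under $\wedge,\vee,\mathbf X,\mathbf U,\mathbf M$; $\Pi_{i+1}$ is the least set containing $\Sigma_i$ closed under $\wedge,\vee,\mathbf X,\mathbf R,\mathbf W$; $\Delta_{i+1}$ is the least set containing $\Sigma_{i+1}\cup\Pi_{i+1}$ closed under $\wedge,\vee$. $B_{\mathbf{GF}}:=\{\mathbf G\mathbf F\psi \mid \exists\chi.\ \chi\mathbf U\psi\in sf(\varphi)\text{ or }\psi\mathbf M\chi\in sf(\varphi)\}$ and $B_{\mathbf{FG}}:=\{\mathbf F\mathbf G\psi\mid\exists\chi.\ \psi\mathbf W\chi\in sf(\varphi)\text{ or }\chi\mathbf R\psi\in sf(\varphi)\}$. For a set $C$ of formulas, $\psi\langle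 C\rangle_\nu$ is defined inductively: it is $\psi$ for $\psi\in\{\mathbf{tt},\mathbf{ff},a,\overline a\}$; homomorphic for $\wedge,\vee,\mathbf X,\mathbf W,\mathbf R$ (e.g. $(\psi_1\mathbf W\psi_2)\langle C\rangle_\nu=\psi_1\langle C\rangle_\nu\mathbf W\psi_2\langle C\rangle_\nu$); $(\psi_1\mathbf U\psi_2)\langle C\rangle_\nu=\psi_1\langle C\rangle_\nu\,\mathbf W\,\psi_2\langle C\rangle_\nu$ if $\mathbf G\mathbf F\psi_2\in C$ and $\mathbf{ff}$ otherwise; $(\psi_1\mathbf M\psi_2)\langle C\rangle_\nu=\psi_1\langle C\rangle_\nu\,\mathbf R\,\psi_2\langle C\rangle_\nu$ if $\mathbf G\mathbf F\psi_1\in C$ and $\mathbf{ff}$ otherwise. Dually, $\psi\langle C\rangle_\mu$ is: $\psi$ for $\psi\in\{\mathbf{tt},\mathbf{ff},a,\overline a\}$; homomorphic for $\wedge,\vee,\mathbf X,\mathbf U,\mathbf M$; $(\psi_1\mathbf W\psi_2)\langle C\rangle_\mu=\psi_1\langle C\rangle_\mu\,\mathbf U\,\psi_2\langle C\rangle_\mu$ if $\mathbf F\mathbf G\psi_1\notin C$ and $\mathbf{tt}$ otherwise; $(\psi_1\mathbf R\psi_2)\langle C\rangle_\mu=\psi_1\langle C\rangle_\mu\,\mathbf M\,\psi_2\langle C\rangle_\mu$ if $\mathbf F\mathbf G\psi_2\notin C$ and $\mathbf{tt}$ otherwise (this is the negation of $\overline\psi\langle\cdot\rangle_\nu$ taken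 in the dual context). $\psi\langle C\rangle_{\Sigma_2}$ is: $\psi$ for $\psi\in\{\mathbf{tt},\mathbf{ff},a,\overline a\}$; homomorphic for $\wedge,\vee,\mathbf X,\mathbf U,\mathbf M$; $(\psi_1\mathbf W\psi_2)\langle C\rangle_{\Sigma_2}=\psi_1\langle C\rangle_{\Sigma_2}\,\mathbf U\,\big(\psi_2\langle C\rangle_{\Sigma_2}\vee\mathbf G(\psi_1\langle C\rangle_\nu)\big)$; $(\psi_1\mathbf R\psi_2)\langle C\rangle_{\Sigma_2}=\big(\psi_1\langle C\rangle_{\Sigma_2}\vee\mathbf G(\psi_2\langle C\rangle_\nu)\big)\,\mathbf M\,\psi_2\langle C\rangle_{\Sigma_2}$. *)

theory Defs
  imports Main "HOL-Library.Omega_Words_Fun" "HOL-Library.Landau_Symbols"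
begin

section \<open>LTL in negation normal form\<close>

datatype (atoms: 'a) ltl =
    TT ("\<^bold>t\<^bold>t")
  | FF ("\<^bold>f\<^bold>f")
  | Prop 'a
  | NProp 'a
  | And "'a ltl" "'a ltl" (infixr "\<^bold>\<and>" 75)
  | Or "'a ltl" "'a ltl" (infixr "\<^bold>\<or>" 74)
  | Next "'a ltl" ("\<^bold>X _" [88] 87)
  | Until "'a ltl" "'a ltl" (infixr "\<^bold>U" 84)
  | WeakUntil "'a ltl" "'a ltl" (infixr "\<^bold>W" 84)
  | Release "'a ltl" "'a ltl" (infixr "\<^bold>R" 84)
  | StrongRelease "'a ltl" "'a ltl" (infixr "\<^bold>M" 84)

abbreviation Finally ("\<^bold>F _" [88] 87) where
  "\<^bold>F \<phi> \<equiv> \<^bold>t\<^bold>t \<^bold>U \<phi>"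

abbreviation Globally ("\<^bold>G _" [88] 87) where
  "\<^bold>G \<phi> \<equiv> \<phi> \<^bold>W \<^bold>f\<^bold>f"

text \<open>
  The formulas over a set \<open>Ap\<close> of atomic propositions are those with \<open>atoms \<phi> \<subseteq> Ap\<close>.
\<close>

definition formulas_over :: "'a set \<Rightarrow> 'a ltl set" where
  "formulas_over Ap = {\<phi>. atoms \<phi> \<subseteq> Ap}"

primrec models :: "'a set word \<Rightarrow> 'a ltl \<Rightarrow> bool" (infix "\<Turnstile>" 50) where
  "w \<Turnstile> \<^bold>t\<^bold>t \<longleftrightarrow> True"
| "w \<Turnstile> \<^bold>f\<^bold>f \<longleftrightarrow> False"
| "w \<Turnstile> Prop a \<longleftrightarrow> a \<in> w 0"
| "w \<Turnstile> NProp a \<longleftrightarrow> a \<notin> w 0"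
| "w \<Turnstile> \<phi> \<^bold>\<and> \<psi> \<longleftrightarrow> w \<Turnstile> \<phi> \<and> w \<Turnstile> \<psi>"
| "w \<Turnstile> \<phi> \<^bold>\<or> \<psi> \<longleftrightarrow> w \<Turnstile> \<phi> \<or> w \<Turnstile> \<psi>"
| "w \<Turnstile> \<^bold>X \<phi> \<longleftrightarrow> suffix 1 w \<Turnstile> \<phi>"
| "w \<Turnstile> \<phi> \<^bold>U \<psi> \<longleftrightarrow> (\<exists>k. suffix k w \<Turnstile> \<psi> \<and> (\<forall>j<k. suffix j w \<Turnstile> \<phi>))"
| "w \<Turnstile> \<phi> \<^bold>W \<psi> \<longleftrightarrow> (\<forall>k. suffix k w \<Turnstile> \<phi>)
      \<or> (\<exists>k. suffix k w \<Turnstile> \<psi> \<and> (\<forall>j<k. suffix j w \<Turnstile> \<phi>))"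
| "w \<Turnstile> \<phi> \<^bold>R \<psi> \<longleftrightarrow> (\<forall>k. suffix k w \<Turnstile> \<psi>)
      \<or> (\<exists>k. suffix k w \<Turnstile> \<phi> \<and> (\<forall>j\<le>k. suffix j w \<Turnstile> \<psi>))"
| "w \<Turnstile> \<phi> \<^bold>M \<psi> \<longleftrightarrow> (\<exists>k. suffix k w \<Turnstile> \<phi> \<and> (\<forall>j\<le>k. suffix j w \<Turnstile> \<psi>))"

definition ltl_equiv :: "'a set \<Rightarrow> 'a ltl \<Rightarrow> 'a ltl \<Rightarrow> bool" where
  "ltl_equiv Ap \<phi> \<psi> \<longleftrightarrow>
     {w. range w \<subseteq> Pow Ap \<and> w \<Turnstile> \<phi>} = {w. range w \<subseteq> Pow Ap \<and> w \<Turnstile> \<psi>}"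

text \<open>Number of nodes of the syntax tree; a negated atom is a single node.\<close>

primrec len :: "'a ltl \<Rightarrow> nat" where
  "len \<^bold>t\<^bold>t = 1"
| "len \<^bold>f\<^bold>f = 1"
| "len (Prop a) = 1"
| "len (NProp a) = 1"
| "len (\<phi> \<^bold>\<and> \<psi>) = len \<phi> + len \<psi> + 1"
| "len (\<phi> \<^bold>\<or> \<psi>) = len \<phi> + len \<psi> + 1"
| "len (\<^bold>X \<phi>) = len \<phi> + 1"
| "len (\<phi> \<^bold>U \<psi>) = len \<phi> + len \<psi> + 1"
| "len (\<phi> \<^bold>W \<psi>) = len \<phi> + len \<psi> + 1"
| "len (\<phi> \<^bold>R \<psi>) = len \<phi> + len \<psi> + 1"
| "len (\<phi> \<^bold>M \<psi>) = len \<phi> + len \<psi> + 1"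

primrec sf :: "'a ltl \<Rightarrow> 'a ltl set" where
  "sf \<^bold>t\<^bold>t = {\<^bold>t\<^bold>t}"
| "sf \<^bold>f\<^bold>f = {\<^bold>f\<^bold>f}"
| "sf (Prop a) = {Prop a}"
| "sf (NProp a) = {NProp a}"
| "sf (\<phi> \<^bold>\<and> \<psi>) = {\<phi> \<^bold>\<and> \<psi>} \<union> sf \<phi> \<union> sf \<psi>"
| "sf (\<phi> \<^bold>\<or> \<psi>) = {\<phi> \<^bold>\<or> \<psi>} \<union> sf \<phi> \<union> sf \<psi>"
| "sf (\<^bold>X \<phi>) = {\<^bold>X \<phi>} \<union> sf \<phi>"
| "sf (\<phi> \<^bold>U \<psi>) = {\<phi> \<^bold>U \<psi>} \<union> sf \<phi> \<union> sf \<psi>"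
| "sf (\<phi> \<^bold>W \<psi>) = {\<phi> \<^bold>W \<psi>} \<union> sf \<phi> \<union> sf \<psi>"
| "sf (\<phi> \<^bold>R \<psi>) = {\<phi> \<^bold>R \<psi>} \<union> sf \<phi> \<union> sf \<psi>"
| "sf (\<phi> \<^bold>M \<psi>) = {\<phi> \<^bold>M \<psi>} \<union> sf \<phi> \<union> sf \<psi>"


section \<open>The syntactic hierarchy\<close>

inductive_set basic_formulas :: "'a set \<Rightarrow> 'a ltl set" for Ap where
  tt: "\<^bold>t\<^bold>t \<in> basic_formulas Ap"
| ff: "\<^bold>f\<^bold>f \<in> basic_formulas Ap"
| atom: "a \<in> Ap \<Longrightarrow> Prop a \<in> basic_formulas Ap"
| natom: "a \<in> Ap \<Longrightarrow> NProp a \<in> basic_formulas Ap"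
| conj: "\<phi> \<in> basic_formulas Ap \<Longrightarrow> \<psi> \<in> basic_formulas Ap \<Longrightarrow> \<phi> \<^bold>\<and> \<psi> \<in> basic_formulas Ap"
| disj: "\<phi> \<in> basic_formulas Ap \<Longrightarrow> \<psi> \<in> basic_formulas Ap \<Longrightarrow> \<phi> \<^bold>\<or> \<psi> \<in> basic_formulas Ap"

inductive_set sigma_closure :: "'a ltl set \<Rightarrow> 'a ltl set" for S where
  base: "\<phi> \<in> S \<Longrightarrow> \<phi> \<in> sigma_closure S"
| conj: "\<phi> \<in> sigma_closure S \<Longrightarrow> \<psi> \<in> sigma_closure S \<Longrightarrow> \<phi> \<^bold>\<and> \<psi> \<in> sigma_closure S"
| disj: "\<phi> \<in> sigma_closure S \<Longrightarrow> \<psi> \<in> sigma_closure S \<Longrightarrow> \<phi> \<^bold>\<or> \<psi> \<in> sigma_closure S"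
| "next": "\<phi> \<in> sigma_closure S \<Longrightarrow> \<^bold>X \<phi> \<in> sigma_closure S"
| until: "\<phi> \<in> sigma_closure S \<Longrightarrow> \<psi> \<in> sigma_closure S \<Longrightarrow> \<phi> \<^bold>U \<psi> \<in> sigma_closure S"
| strong_release: "\<phi> \<in> sigma_closure S \<Longrightarrow> \<psi> \<in> sigma_closure S \<Longrightarrow> \<phi> \<^bold>M \<psi> \<in> sigma_closure S"

inductive_set pi_closure :: "'a ltl set \<Rightarrow> 'a ltl set" for S where
  base: "\<phi> \<in> S \<Longrightarrow> \<phi> \<in> pi_closure S"
| conj: "\<phi> \<in> pi_closure S \<Longrightarrow> \<psi> \<in> pi_closure S \<Longrightarrow> \<phi> \<^bold>\<and> \<psi> \<in> pi_closure S"
| disj: "\<phi> \<in> pi_closure S \<Longrightarrow> \<psi> \<in> pi_closure S \<Longrightarrow> \<phi> \<^bold>\<or> \<psi> \<in> pi_closure S"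
| "next": "\<phi> \<in> pi_closure S \<Longrightarrow> \<^bold>X \<phi> \<in> pi_closure S"
| release: "\<phi> \<in> pi_closure S \<Longrightarrow> \<psi> \<in> pi_closure S \<Longrightarrow> \<phi> \<^bold>R \<psi> \<in> pi_closure S"
| weak_until: "\<phi> \<in> pi_closure S \<Longrightarrow> \<psi> \<in> pi_closure S \<Longrightarrow> \<phi> \<^bold>W \<psi> \<in> pi_closure S"

inductive_set boolean_closure :: "'a ltl set \<Rightarrow> 'a ltl set" for S where
  base: "\<phi> \<in> S \<Longrightarrow> \<phi> \<in> boolean_closure S"
| conj: "\<phi> \<in> boolean_closure S \<Longrightarrow> \<psi> \<in> boolean_closure S \<Longrightarrow> \<phi> \<^bold>\<and> \<psi> \<in> boolean_closure S"
| disj: "\<phi> \<in> boolean_closure S \<Longrightarrow> \<psi> \<in> boolean_closure S \<Longrightarrow> \<phi> \<^bold>\<or> \<psi> \<in> boolean_closure S"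

fun Sigma_ltl :: "'a set \<Rightarrow> nat \<Rightarrow> 'a ltl set" and Pi_ltl :: "'a set \<Rightarrow> nat \<Rightarrow> 'a ltl set" where
  "Sigma_ltl Ap 0 = basic_formulas Ap"
| "Sigma_ltl Ap (Suc i) = sigma_closure (Pi_ltl Ap i)"
| "Pi_ltl Ap 0 = basic_formulas Ap"
| "Pi_ltl Ap (Suc i) = pi_closure (Sigma_ltl Ap i)"

fun Delta_ltl :: "'a set \<Rightarrow> nat \<Rightarrow> 'a ltl set" where
  "Delta_ltl Ap 0 = basic_formulas Ap"
| "Delta_ltl Ap (Suc i) = boolean_closure (Sigma_ltl Ap (Suc i) \<union> Pi_ltl Ap (Suc i))"


section \<open>The normal form\<close>

definition B_GF :: "'a ltl \<Rightarrow> 'a ltl set" where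
  "B_GF \<phi> = {\<^bold>G (\<^bold>F \<psi>) | \<psi>. \<exists>\<chi>. \<chi> \<^bold>U \<psi> \<in> sf \<phi> \<or> \<psi> \<^bold>M \<chi> \<in> sf \<phi>}"

definition B_FG :: "'a ltl \<Rightarrow> 'a ltl set" where
  "B_FG \<phi> = {\<^bold>F (\<^bold>G \<psi>) | \<psi>. \<exists>\<chi>. \<psi> \<^bold>W \<chi> \<in> sf \<phi> \<or> \<chi> \<^bold>R \<psi> \<in> sf \<phi>}"

primrec nu :: "'a ltl \<Rightarrow> 'a ltl set \<Rightarrow> 'a ltl" ("_\<langle>_\<rangle>\<^sub>\<nu>" [90, 0] 89) where
  "\<^bold>t\<^bold>t\<langle>C\<rangle>\<^sub>\<nu> = \<^bold>t\<^bold>t"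
| "\<^bold>f\<^bold>f\<langle>C\<rangle>\<^sub>\<nu> = \<^bold>f\<^bold>f"
| "(Prop a)\<langle>C\<rangle>\<^sub>\<nu> = Prop a"
| "(NProp a)\<langle>C\<rangle>\<^sub>\<nu> = NProp a"
| "(\<phi> \<^bold>\<and> \<psi>)\<langle>C\<rangle>\<^sub>\<nu> = \<phi>\<langle>C\<rangle>\<^sub>\<nu> \<^bold>\<and> \<psi>\<langle>C\<rangle>\<^sub>\<nu>"
| "(\<phi> \<^bold>\<or> \<psi>)\<langle>C\<rangle>\<^sub>\<nu> = \<phi>\<langle>C\<rangle>\<^sub>\<nu> \<^bold>\<or> \<psi>\<langle>C\<rangle>\<^sub>\<nu>"
| "(\<^bold>X \<phi>)\<langle>C\<rangle>\<^sub>\<nu> = \<^bold>X (\<phi>\<langle>C\<rangle>\<^sub>\<nu>)"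
| "(\<phi> \<^bold>U \<psi>)\<langle>C\<rangle>\<^sub>\<nu> = (if \<^bold>G (\<^bold>F \<psi>) \<in> C then \<phi>\<langle>C\<rangle>\<^sub>\<nu> \<^bold>W \<psi>\<langle>C\<rangle>\<^sub>\<nu> else \<^bold>f\<^bold>f)"
| "(\<phi> \<^bold>W \<psi>)\<langle>C\<rangle>\<^sub>\<nu> = \<phi>\<langle>C\<rangle>\<^sub>\<nu> \<^bold>W \<psi>\<langle>C\<rangle>\<^sub>\<nu>"
| "(\<phi> \<^bold>R \<psi>)\<langle>C\<rangle>\<^sub>\<nu> = \<phi>\<langle>C\<rangle>\<^sub>\<nu> \<^bold>R \<psi>\<langle>C\<rangle>\<^sub>\<nu>"
| "(\<phi> \<^bold>M \<psi>)\<langle>C\<rangle>\<^sub>\<nu> = (if \<^bold>G (\<^bold>F \<phi>) \<in> C then \<phi>\<langle>C\<rangle>\<^sub>\<nu> \<^bold>R \<psi>\<langle>C\<rangle>\<^sub>\<nu> else \<^bold>f\<^bold>f)"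

primrec mu :: "'a ltl \<Rightarrow> 'a ltl set \<Rightarrow> 'a ltl" ("_\<langle>_\<rangle>\<^sub>\<mu>" [90, 0] 89) where
  "\<^bold>t\<^bold>t\<langle>C\<rangle>\<^sub>\<mu> = \<^bold>t\<^bold>t"
| "\<^bold>f\<^bold>f\<langle>C\<rangle>\<^sub>\<mu> = \<^bold>f\<^bold>f"
| "(Prop a)\<langle>C\<rangle>\<^sub>\<mu> = Prop a"
| "(NProp a)\<langle>C\<rangle>\<^sub>\<mu> = NProp a"
| "(\<phi> \<^bold>\<and> \<psi>)\<langle>C\<rangle>\<^sub>\<mu> = \<phi>\<langle>C\<rangle>\<^sub>\<mu> \<^bold>\<and> \<psi>\<langle>C\<rangle>\<^sub>\<mu>"
| "(\<phi> \<^bold>\<or> \<psi>)\<langle>C\<rangle>\<^sub>\<mu> = \<phi>\<langle>C\<rangle>\<^sub>\<mu> \<^bold>\<or> \<psi>\<langle>C\<rangle>\<^sub>\<mu>"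
| "(\<^bold>X \<phi>)\<langle>C\<rangle>\<^sub>\<mu> = \<^bold>X (\<phi>\<langle>C\<rangle>\<^sub>\<mu>)"
| "(\<phi> \<^bold>U \<psi>)\<langle>C\<rangle>\<^sub>\<mu> = \<phi>\<langle>C\<rangle>\<^sub>\<mu> \<^bold>U \<psi>\<langle>C\<rangle>\<^sub>\<mu>"
| "(\<phi> \<^bold>W \<psi>)\<langle>C\<rangle>\<^sub>\<mu> = (if \<^bold>F (\<^bold>G \<phi>) \<notin> C then \<phi>\<langle>C\<rangle>\<^sub>\<mu> \<^bold>U \<psi>\<langle>C\<rangle>\<^sub>\<mu> else \<^bold>t\<^bold>t)"
| "(\<phi> \<^bold>R \<psi>)\<langle>C\<rangle>\<^sub>\<mu> = (if \<^bold>F (\<^bold>G \<psi>) \<notin> C then \<phi>\<langle>C\<rangle>\<^sub>\<mu> \<^bold>M \<psi>\<langle>C\<rangle>\<^sub>\<mu> else \<^bold>t\<^bold>t)"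
| "(\<phi> \<^bold>M \<psi>)\<langle>C\<rangle>\<^sub>\<mu> = \<phi>\<langle>C\<rangle>\<^sub>\<mu> \<^bold>M \<psi>\<langle>C\<rangle>\<^sub>\<mu>"

primrec sigma2 :: "'a ltl \<Rightarrow> 'a ltl set \<Rightarrow> 'a ltl" ("_\<langle>_\<rangle>\<^sub>\<Sigma>\<^sub>2" [90, 0] 89) where
  "\<^bold>t\<^bold>t\<langle>C\<rangle>\<^sub>\<Sigma>\<^sub>2 = \<^bold>t\<^bold>t"
| "\<^bold>f\<^bold>f\<langle>C\<rangle>\<^sub>\<Sigma>\<^sub>2 = \<^bold>f\<^bold>f"
| "(Prop a)\<langle>C\<rangle>\<^sub>\<Sigma>\<^sub>2 = Prop a"
| "(NProp a)\<langle>C\<rangle>\<^sub>\<Sigma>\<^sub>2 = NProp a"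
| "(\<phi> \<^bold>\<and> \<psi>)\<langle>C\<rangle>\<^sub>\<Sigma>\<^sub>2 = \<phi>\<langle>C\<rangle>\<^sub>\<Sigma>\<^sub>2 \<^bold>\<and> \<psi>\<langle>C\<rangle>\<^sub>\<Sigma>\<^sub>2"
| "(\<phi> \<^bold>\<or> \<psi>)\<langle>C\<rangle>\<^sub>\<Sigma>\<^sub>2 = \<phi>\<langle>C\<rangle>\<^sub>\<Sigma>\<^sub>2 \<^bold>\<or> \<psi>\<langle>C\<rangle>\<^sub>\<Sigma>\<^sub>2"
| "(\<^bold>X \<phi>)\<langle>C\<rangle>\<^sub>\<Sigma>\<^sub>2 = \<^bold>X (\<phi>\<langle>C\<rangle>\<^sub>\<Sigma>\<^sub>2)"
| "(\<phi> \<^bold>U \<psi>)\<langle>C\<rangle>\<^sub>\<Sigma>\<^sub>2 = \<phi>\<langle>C\<rangle>\<^sub>\<Sigma>\<^sub>2 \<^bold>U \<psi>\<langle>C\<rangle>\<^sub>\<Sigma>\<^sub>2"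
| "(\<phi> \<^bold>W \<psi>)\<langle>C\<rangle>\<^sub>\<Sigma>\<^sub>2 = \<phi>\<langle>C\<rangle>\<^sub>\<Sigma>\<^sub>2 \<^bold>U (\<psi>\<langle>C\<rangle>\<^sub>\<Sigma>\<^sub>2 \<^bold>\<or> \<^bold>G (\<phi>\<langle>C\<rangle>\<^sub>\<nu>))"
| "(\<phi> \<^bold>R \<psi>)\<langle>C\<rangle>\<^sub>\<Sigma>\<^sub>2 = (\<phi>\<langle>C\<rangle>\<^sub>\<Sigma>\<^sub>2 \<^bold>\<or> \<^bold>G (\<psi>\<langle>C\<rangle>\<^sub>\<nu>)) \<^bold>M \<psi>\<langle>C\<rangle>\<^sub>\<Sigma>\<^sub>2"
| "(\<phi> \<^bold>M \<psi>)\<langle>C\<rangle>\<^sub>\<Sigma>\<^sub>2 = \<phi>\<langle>C\<rangle>\<^sub>\<Sigma>\<^sub>2 \<^bold>M \<psi>\<langle>C\<rangle>\<^sub>\<Sigma>\<^sub>2"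

text \<open>
  Finite conjunctions and disjunctions indexed by a finite set. Each index contributes exactly
  one operand, also when different indices give the same formula. The operands are taken in an
  arbitrary but fixed order; it affects neither the length nor the semantics. The right-nested
  chain ends with the neutral element, so that empty conjunctions are \<open>\<^bold>t\<^bold>t\<close> and
  empty disjunctions are \<open>\<^bold>f\<^bold>f\<close>.
\<close>

definition enumeration :: "'i set \<Rightarrow> 'i list" where
  "enumeration I = (SOME xs. set xs = I \<and> distinct xs)"

definition Conj :: "'i set \<Rightarrow> ('i \<Rightarrow> 'a ltl) \<Rightarrow> 'a ltl" where
  "Conj I f = foldr (\<lambda>i \<phi>. f i \<^bold>\<and> \<phi>) (enumeration I) \<^bold>t\<^bold>t"

definition Disj :: "'i set \<Rightarrow> ('i \<Rightarrow> 'a ltl) \<Rightarrow> 'a ltl" where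
  "Disj I f = foldr (\<lambda>i \<phi>. f i \<^bold>\<or> \<phi>) (enumeration I) \<^bold>f\<^bold>f"

text \<open>
  Since \<open>\<psi> \<mapsto> \<^bold>F (\<^bold>G \<psi>)\<close> is injective, indexing by the \<open>\<psi>\<close> with
  \<open>\<^bold>F (\<^bold>G \<psi>) \<in> N\<close> is the same as indexing by the elements of \<open>N\<close>; likewise for \<open>M\<close>.
\<close>

definition normal_form :: "'a ltl \<Rightarrow> 'a ltl" where
  "normal_form \<phi> =
     Disj (Pow (B_GF \<phi>) \<times> Pow (B_FG \<phi>)) (\<lambda>(M, N).
       \<phi>\<langle>M\<rangle>\<^sub>\<Sigma>\<^sub>2
       \<^bold>\<and> Conj {\<psi>. \<^bold>F (\<^bold>G \<psi>) \<in> N} (\<lambda>\<psi>. \<^bold>F (\<^bold>G (\<psi>\<langle>M\<rangle>\<^sub>\<nu>)))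
       \<^bold>\<and> Conj {\<psi>. \<^bold>G (\<^bold>F \<psi>) \<in> M} (\<lambda>\<psi>. \<^bold>G (\<^bold>F (\<psi>\<langle>N\<rangle>\<^sub>\<mu>))))"

end

theory Submission
  imports Defs
begin

text \<open>
  The disjunct for \<open>M\<close> and \<open>N\<close> guesses which \<open>\<^bold>G (\<^bold>F \<psi>)\<close> and \<open>\<^bold>F (\<^bold>G \<psi>)\<close> hold on the word. If the guess
  is the exact one, then on all late enough suffixes \<open>\<^bold>F \<psi>\<close> holds only if \<open>\<^bold>G (\<^bold>F \<psi>) \<in> M\<close>, so there every
  satisfied formula also satisfies its \<open>\<nu>\<close>-translation; this is what lets the \<open>\<Sigma>\<^sub>2\<close>-translation
  replace a weak until by an until whose goal is \<open>\<^bold>G (\<phi>\<langle>M\<rangle>\<^sub>\<nu>)\<close>. Conversely, a disjunct that holds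
  certifies its own guess: the circular dependency between \<open>M\<close> and \<open>N\<close> is resolved by induction on
  the length of \<open>\<psi>\<close>, because \<open>\<psi>\<langle>M\<rangle>\<^sub>\<nu>\<close> and \<open>\<psi>\<langle>N\<rangle>\<^sub>\<mu>\<close> consult \<open>M\<close> and \<open>N\<close> only at strictly shorter formulas.
\<close>

section \<open>Semantics\<close>

(* Otherwise simp unfolds suffix k w in premises to \<lambda>n. w (k + n). *)
declare suffix_nth [simp del]

text \<open>Counting over all positions makes the two limit properties independent of the suffix at
  which they are evaluated, so they can be stated once for \<open>w\<close> and used at every
  position \<open>k\<close>.\<close>

lemma models_GF: "w \<Turnstile> \<^bold>G (\<^bold>F \<psi>) \<longleftrightarrow> (\<exists>\<^sub>\<infinity>i. suffix i w \<Turnstile> \<psi>)"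
  by (simp add: INFM_nat_le) (metis le_add1 le_iff_add)

lemma models_FG: "w \<Turnstile> \<^bold>F (\<^bold>G \<psi>) \<longleftrightarrow> (\<forall>\<^sub>\<infinity>i. suffix i w \<Turnstile> \<psi>)"
  by (simp add: MOST_nat_le) (metis le_add1 le_iff_add)

lemma INFM_imp_ex_suffix: "\<exists>\<^sub>\<infinity>i. suffix i w \<Turnstile> \<psi> \<Longrightarrow> \<exists>j. suffix (k + j) w \<Turnstile> \<psi>"
  unfolding INFM_nat_le by (metis le_iff_add)

lemma all_suffix_imp_MOST: "\<forall>j. suffix (k + j) w \<Turnstile> \<psi> \<Longrightarrow> \<forall>\<^sub>\<infinity>i. suffix i w \<Turnstile> \<psi>"
  unfolding MOST_nat_le by (metis le_iff_add)

section \<open>Soundness of the three translations\<close>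

text \<open>A weak until that replaces an until cannot be satisfied without its goal: the
  replacement happens only when GF of the goal is in \<open>C\<close>, so the goal recurs after
  every position. The goal is a proper subformula, hence the length bound, which is what lets
  \<open>guess_sound\<close> apply the lemma inductively.\<close>

lemma nu_sound:
  assumes "\<And>\<psi>. \<^bold>G (\<^bold>F \<psi>) \<in> C \<Longrightarrow> len \<psi> < len \<phi> \<Longrightarrow> \<exists>\<^sub>\<infinity>i. suffix i w \<Turnstile> \<psi>"
    and "suffix k w \<Turnstile> \<phi>\<langle>C\<rangle>\<^sub>\<nu>"
  shows "suffix k w \<Turnstile> \<phi>"
  using assms
proof (induction \<phi> arbitrary: k)
  case (Until \<phi>1 \<phi>2)
  have 1: "suffix k w \<Turnstile> \<phi>1" if "suffix k w \<Turnstile> \<phi>1\<langle>C\<rangle>\<^sub>\<nu>" for k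
    using Until.IH(1)[OF _ that] Until.prems(1) by simp
  have 2: "suffix k w \<Turnstile> \<phi>2" if "suffix k w \<Turnstile> \<phi>2\<langle>C\<rangle>\<^sub>\<nu>" for k
    using Until.IH(2)[OF _ that] Until.prems(1) by simp
  have mem: "\<^bold>G (\<^bold>F \<phi>2) \<in> C" and "suffix k w \<Turnstile> \<phi>1\<langle>C\<rangle>\<^sub>\<nu> \<^bold>W \<phi>2\<langle>C\<rangle>\<^sub>\<nu>"
    using Until.prems(2) by (auto split: if_splits)
  moreover have "\<exists>j. suffix (k + j) w \<Turnstile> \<phi>2"
    using Until.prems(1)[OF mem] by (simp add: INFM_imp_ex_suffix)
  ultimately show ?case using 1 2 by auto
next
  case (StrongRelease \<phi>1 \<phi>2)
  have 1: "suffix k w \<Turnstile> \<phi>1" if "suffix k w \<Turnstile> \<phi>1\<langle>C\<rangle>\<^sub>\<nu>" for k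
    using StrongRelease.IH(1)[OF _ that] StrongRelease.prems(1) by simp
  have 2: "suffix k w \<Turnstile> \<phi>2" if "suffix k w \<Turnstile> \<phi>2\<langle>C\<rangle>\<^sub>\<nu>" for k
    using StrongRelease.IH(2)[OF _ that] StrongRelease.prems(1) by simp
  have mem: "\<^bold>G (\<^bold>F \<phi>1) \<in> C" and "suffix k w \<Turnstile> \<phi>1\<langle>C\<rangle>\<^sub>\<nu> \<^bold>R \<phi>2\<langle>C\<rangle>\<^sub>\<nu>"
    using StrongRelease.prems(2) by (auto split: if_splits)
  moreover have "\<exists>j. suffix (k + j) w \<Turnstile> \<phi>1"
    using StrongRelease.prems(1)[OF mem] by (simp add: INFM_imp_ex_suffix)
  ultimately show ?case using 1 2 by auto
next
  case (WeakUntil \<phi>1 \<phi>2)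
  have 1: "suffix k w \<Turnstile> \<phi>1" if "suffix k w \<Turnstile> \<phi>1\<langle>C\<rangle>\<^sub>\<nu>" for k
    using WeakUntil.IH(1)[OF _ that] WeakUntil.prems(1) by simp
  have 2: "suffix k w \<Turnstile> \<phi>2" if "suffix k w \<Turnstile> \<phi>2\<langle>C\<rangle>\<^sub>\<nu>" for k
    using WeakUntil.IH(2)[OF _ that] WeakUntil.prems(1) by simp
  show ?case using 1 2 WeakUntil.prems(2) by simp blast
next
  case (Release \<phi>1 \<phi>2)
  have 1: "suffix k w \<Turnstile> \<phi>1" if "suffix k w \<Turnstile> \<phi>1\<langle>C\<rangle>\<^sub>\<nu>" for k
    using Release.IH(1)[OF _ that] Release.prems(1) by simp
  have 2: "suffix k w \<Turnstile> \<phi>2" if "suffix k w \<Turnstile> \<phi>2\<langle>C\<rangle>\<^sub>\<nu>" for k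
    using Release.IH(2)[OF _ that] Release.prems(1) by simp
  show ?case using 1 2 Release.prems(2) by simp blast
qed auto

text \<open>Turning weak until into until only strengthens it; the critical case is the replacement
  by true. There the left argument must hold from the current position on, so the members of
  \<open>C\<close> are required at every position of \<open>w\<close>. The word is generalised
  because this requirement passes to suffixes.\<close>

lemma mu_sound:
  assumes "\<And>\<psi> k. \<^bold>F (\<^bold>G \<psi>) \<in> C \<Longrightarrow> len \<psi> < len \<phi> \<Longrightarrow> suffix k w \<Turnstile> \<psi>"
    and "w \<Turnstile> \<phi>\<langle>C\<rangle>\<^sub>\<mu>"
  shows "w \<Turnstile> \<phi>"
  using assms
proof (induction \<phi> arbitrary: w)
  case (Until \<phi>1 \<phi>2)
  then have "suffix k w \<Turnstile> \<phi>1\<langle>C\<rangle>\<^sub>\<mu> \<Longrightarrow> suffix k w \<Turnstile> \<phi>1"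
    and "suffix k w \<Turnstile> \<phi>2\<langle>C\<rangle>\<^sub>\<mu> \<Longrightarrow> suffix k w \<Turnstile> \<phi>2" for k
    by simp_all
  then show ?case using Until.prems(2) by auto
next
  case (StrongRelease \<phi>1 \<phi>2)
  then have "suffix k w \<Turnstile> \<phi>1\<langle>C\<rangle>\<^sub>\<mu> \<Longrightarrow> suffix k w \<Turnstile> \<phi>1"
    and "suffix k w \<Turnstile> \<phi>2\<langle>C\<rangle>\<^sub>\<mu> \<Longrightarrow> suffix k w \<Turnstile> \<phi>2" for k
    by simp_all
  then show ?case using StrongRelease.prems(2) by auto
next
  case (WeakUntil \<phi>1 \<phi>2)
  then have "suffix k w \<Turnstile> \<phi>1\<langle>C\<rangle>\<^sub>\<mu> \<Longrightarrow> suffix k w \<Turnstile> \<phi>1"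
    and "suffix k w \<Turnstile> \<phi>2\<langle>C\<rangle>\<^sub>\<mu> \<Longrightarrow> suffix k w \<Turnstile> \<phi>2"
    and "\<^bold>F (\<^bold>G \<phi>1) \<in> C \<Longrightarrow> suffix k w \<Turnstile> \<phi>1" for k
    by simp_all
  then show ?case using WeakUntil.prems(2) by (simp split: if_splits) blast
next
  case (Release \<phi>1 \<phi>2)
  then have "suffix k w \<Turnstile> \<phi>1\<langle>C\<rangle>\<^sub>\<mu> \<Longrightarrow> suffix k w \<Turnstile> \<phi>1"
    and "suffix k w \<Turnstile> \<phi>2\<langle>C\<rangle>\<^sub>\<mu> \<Longrightarrow> suffix k w \<Turnstile> \<phi>2"
    and "\<^bold>F (\<^bold>G \<phi>2) \<in> C \<Longrightarrow> suffix k w \<Turnstile> \<phi>2" for k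
    by simp_all
  then show ?case using Release.prems(2) by (simp split: if_splits) blast
qed auto

text \<open>The until that replaces a weak until can end in two ways: at its original goal, or at a
  point from which the \<open>nu\<close> translation of the left argument holds forever. In the
  second case \<open>nu_sound\<close> shows that the left argument itself never fails.\<close>

lemma sigma2_sound:
  assumes "\<And>\<psi>. \<^bold>G (\<^bold>F \<psi>) \<in> C \<Longrightarrow> \<exists>\<^sub>\<infinity>i. suffix i w \<Turnstile> \<psi>"
    and "suffix k w \<Turnstile> \<phi>\<langle>C\<rangle>\<^sub>\<Sigma>\<^sub>2"
  shows "suffix k w \<Turnstile> \<phi>"
  using assms
proof (induction \<phi> arbitrary: k)
  case (Until \<phi>1 \<phi>2)
  have 1: "suffix k w \<Turnstile> \<phi>1" if "suffix k w \<Turnstile> \<phi>1\<langle>C\<rangle>\<^sub>\<Sigma>\<^sub>2" for k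
    using Until.IH(1)[OF _ that] Until.prems(1) by simp
  have 2: "suffix k w \<Turnstile> \<phi>2" if "suffix k w \<Turnstile> \<phi>2\<langle>C\<rangle>\<^sub>\<Sigma>\<^sub>2" for k
    using Until.IH(2)[OF _ that] Until.prems(1) by simp
  show ?case using 1 2 Until.prems(2) by auto
next
  case (StrongRelease \<phi>1 \<phi>2)
  have 1: "suffix k w \<Turnstile> \<phi>1" if "suffix k w \<Turnstile> \<phi>1\<langle>C\<rangle>\<^sub>\<Sigma>\<^sub>2" for k
    using StrongRelease.IH(1)[OF _ that] StrongRelease.prems(1) by simp
  have 2: "suffix k w \<Turnstile> \<phi>2" if "suffix k w \<Turnstile> \<phi>2\<langle>C\<rangle>\<^sub>\<Sigma>\<^sub>2" for k
    using StrongRelease.IH(2)[OF _ that] StrongRelease.prems(1) by simp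
  show ?case using 1 2 StrongRelease.prems(2) by auto
next
  case (WeakUntil \<phi>1 \<phi>2)
  have 1: "suffix k w \<Turnstile> \<phi>1" if "suffix k w \<Turnstile> \<phi>1\<langle>C\<rangle>\<^sub>\<Sigma>\<^sub>2" for k
    using WeakUntil.IH(1)[OF _ that] WeakUntil.prems(1) by simp
  have 2: "suffix k w \<Turnstile> \<phi>2" if "suffix k w \<Turnstile> \<phi>2\<langle>C\<rangle>\<^sub>\<Sigma>\<^sub>2" for k
    using WeakUntil.IH(2)[OF _ that] WeakUntil.prems(1) by simp
  have 3: "suffix k w \<Turnstile> \<phi>1" if "suffix k w \<Turnstile> \<phi>1\<langle>C\<rangle>\<^sub>\<nu>" for k
    using nu_sound[OF _ that] WeakUntil.prems(1) by simp
  \<comment> \<open>\<open>m\<close> is the offset from \<open>k\<close> at which the new until is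
    fulfilled; which of its two goals is met there is decided below.\<close>
  obtain m where m: "suffix (k + m) w \<Turnstile> \<phi>2\<langle>C\<rangle>\<^sub>\<Sigma>\<^sub>2 \<or> (\<forall>i. suffix (k + (m + i)) w \<Turnstile> \<phi>1\<langle>C\<rangle>\<^sub>\<nu>)"
    "\<forall>j<m. suffix (k + j) w \<Turnstile> \<phi>1\<langle>C\<rangle>\<^sub>\<Sigma>\<^sub>2"
    using WeakUntil.prems(2) by (auto simp: add.assoc)
  show ?case
  proof (cases "suffix (k + m) w \<Turnstile> \<phi>2\<langle>C\<rangle>\<^sub>\<Sigma>\<^sub>2")
    case True
    then show ?thesis using 1 2 m(2) by simp blast
  next
    case False
    \<comment> \<open>Positions before \<open>m\<close> are covered by the \<open>sigma2\<close>
      translation, the others by the \<open>nu\<close> translation.\<close>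
    have "suffix (k + j) w \<Turnstile> \<phi>1" for j
    proof (cases "j < m")
      case True
      then show ?thesis using m(2) 1 by auto
    next
      case ge: False
      then obtain i where "j = m + i" by (metis not_less le_iff_add)
      then show ?thesis using m(1) False 3 by auto
    qed
    then show ?thesis by simp
  qed
next
  case (Release \<phi>1 \<phi>2)
  have 1: "suffix k w \<Turnstile> \<phi>1" if "suffix k w \<Turnstile> \<phi>1\<langle>C\<rangle>\<^sub>\<Sigma>\<^sub>2" for k
    using Release.IH(1)[OF _ that] Release.prems(1) by simp
  have 2: "suffix k w \<Turnstile> \<phi>2" if "suffix k w \<Turnstile> \<phi>2\<langle>C\<rangle>\<^sub>\<Sigma>\<^sub>2" for k
    using Release.IH(2)[OF _ that] Release.prems(1) by simp
  have 3: "suffix k w \<Turnstile> \<phi>2" if "suffix k w \<Turnstile> \<phi>2\<langle>C\<rangle>\<^sub>\<nu>" for k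
    using nu_sound[OF _ that] Release.prems(1) by simp
  obtain m where m: "suffix (k + m) w \<Turnstile> \<phi>1\<langle>C\<rangle>\<^sub>\<Sigma>\<^sub>2 \<or> (\<forall>i. suffix (k + (m + i)) w \<Turnstile> \<phi>2\<langle>C\<rangle>\<^sub>\<nu>)"
    "\<forall>j\<le>m. suffix (k + j) w \<Turnstile> \<phi>2\<langle>C\<rangle>\<^sub>\<Sigma>\<^sub>2"
    using Release.prems(2) by (auto simp: add.assoc)
  show ?case
  proof (cases "suffix (k + m) w \<Turnstile> \<phi>1\<langle>C\<rangle>\<^sub>\<Sigma>\<^sub>2")
    case True
    then show ?thesis using 1 2 m(2) by simp blast
  next
    case False
    have "suffix (k + j) w \<Turnstile> \<phi>2" for j
    proof (cases "j < m")
      case True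
      then show ?thesis using m(2) 2 by auto
    next
      case ge: False
      then obtain i where "j = m + i" by (metis not_less le_iff_add)
      then show ?thesis using m(1) False 3 by auto
    qed
    then show ?thesis by simp
  qed
qed auto

section \<open>Arguments of the two bases\<close>

text \<open>The generators of \<open>B_GF\<close> without their GF prefix. Unlike the prefixed
  formulas they are themselves subformulas, so they can be compared with \<open>sf\<close> and
  counted there.\<close>

definition GF_args :: "'a ltl \<Rightarrow> 'a ltl set" where
  "GF_args \<phi> = {\<psi>. \<exists>\<chi>. \<chi> \<^bold>U \<psi> \<in> sf \<phi> \<or> \<psi> \<^bold>M \<chi> \<in> sf \<phi>}"

definition FG_args :: "'a ltl \<Rightarrow> 'a ltl set" where
  "FG_args \<phi> = {\<psi>. \<exists>\<chi>. \<psi> \<^bold>W \<chi> \<in> sf \<phi> \<or> \<chi> \<^bold>R \<psi> \<in> sf \<phi>}"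

lemma GF_args_simps [simp]:
  "GF_args \<^bold>t\<^bold>t = {}"
  "GF_args \<^bold>f\<^bold>f = {}"
  "GF_args (Prop a) = {}"
  "GF_args (NProp a) = {}"
  "GF_args (\<^bold>X \<phi>) = GF_args \<phi>"
  "GF_args (\<phi> \<^bold>\<and> \<psi>) = GF_args \<phi> \<union> GF_args \<psi>"
  "GF_args (\<phi> \<^bold>\<or> \<psi>) = GF_args \<phi> \<union> GF_args \<psi>"
  "GF_args (\<phi> \<^bold>U \<psi>) = insert \<psi> (GF_args \<phi> \<union> GF_args \<psi>)"
  "GF_args (\<phi> \<^bold>W \<psi>) = GF_args \<phi> \<union> GF_args \<psi>"
  "GF_args (\<phi> \<^bold>R \<psi>) = GF_args \<phi> \<union> GF_args \<psi>"
  "GF_args (\<phi> \<^bold>M \<psi>) = insert \<phi> (GF_args \<phi> \<union> GF_args \<psi>)"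
  by (auto simp: GF_args_def)

lemma FG_args_simps [simp]:
  "FG_args \<^bold>t\<^bold>t = {}"
  "FG_args \<^bold>f\<^bold>f = {}"
  "FG_args (Prop a) = {}"
  "FG_args (NProp a) = {}"
  "FG_args (\<^bold>X \<phi>) = FG_args \<phi>"
  "FG_args (\<phi> \<^bold>\<and> \<psi>) = FG_args \<phi> \<union> FG_args \<psi>"
  "FG_args (\<phi> \<^bold>\<or> \<psi>) = FG_args \<phi> \<union> FG_args \<psi>"
  "FG_args (\<phi> \<^bold>U \<psi>) = FG_args \<phi> \<union> FG_args \<psi>"
  "FG_args (\<phi> \<^bold>W \<psi>) = insert \<phi> (FG_args \<phi> \<union> FG_args \<psi>)"
  "FG_args (\<phi> \<^bold>R \<psi>) = insert \<psi> (FG_args \<phi> \<union> FG_args \<psi>)"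
  "FG_args (\<phi> \<^bold>M \<psi>) = FG_args \<phi> \<union> FG_args \<psi>"
  by (auto simp: FG_args_def)

lemma B_GF_eq: "B_GF \<phi> = (\<lambda>\<psi>. \<^bold>G (\<^bold>F \<psi>)) ` GF_args \<phi>"
  unfolding B_GF_def GF_args_def by blast

lemma B_FG_eq: "B_FG \<phi> = (\<lambda>\<psi>. \<^bold>F (\<^bold>G \<psi>)) ` FG_args \<phi>"
  unfolding B_FG_def FG_args_def by blast

lemma sf_refl [simp]: "\<phi> \<in> sf \<phi>"
  by (cases \<phi>) auto

lemma sf_subset: "\<psi> \<in> sf \<phi> \<Longrightarrow> sf \<psi> \<subseteq> sf \<phi>"
  by (induction \<phi>) auto

lemma finite_sf [simp]: "finite (sf \<phi>)"
  by (induction \<phi>) auto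

lemma GF_args_subset_sf: "GF_args \<phi> \<subseteq> sf \<phi>"
  by (induction \<phi>) auto

lemma FG_args_subset_sf: "FG_args \<phi> \<subseteq> sf \<phi>"
  by (induction \<phi>) auto

lemma GF_args_mono: "\<psi> \<in> sf \<phi> \<Longrightarrow> GF_args \<psi> \<subseteq> GF_args \<phi>"
  unfolding GF_args_def using sf_subset by blast

lemma FG_args_mono: "\<psi> \<in> sf \<phi> \<Longrightarrow> FG_args \<psi> \<subseteq> FG_args \<phi>"
  unfolding FG_args_def using sf_subset by blast

lemma finite_GF_args [simp]: "finite (GF_args \<phi>)"
  using GF_args_subset_sf finite_sf by (rule finite_subset)

lemma finite_FG_args [simp]: "finite (FG_args \<phi>)"
  using FG_args_subset_sf finite_sf by (rule finite_subset)

section \<open>Completeness of the three translations\<close>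

text \<open>An until or strong release that holds at some position has its eventuality satisfied
  somewhere, so its GF formula is in \<open>C\<close> and the subformula is not replaced by false.
  Apart from that, \<open>nu\<close> only weakens operators.\<close>

lemma nu_complete:
  assumes "\<And>\<psi> k. \<psi> \<in> GF_args \<phi> \<Longrightarrow> suffix k w \<Turnstile> \<psi> \<Longrightarrow> \<^bold>G (\<^bold>F \<psi>) \<in> C"
    and "w \<Turnstile> \<phi>"
  shows "w \<Turnstile> \<phi>\<langle>C\<rangle>\<^sub>\<nu>"
  using assms
proof (induction \<phi> arbitrary: w)
  case (Next \<phi>)
  have "suffix 1 w \<Turnstile> \<phi>\<langle>C\<rangle>\<^sub>\<nu>" if "suffix 1 w \<Turnstile> \<phi>"
    using Next.IH[OF _ that] Next.prems(1) by simp
  then show ?case using Next.prems(2) by simp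
next
  case (Until \<phi>1 \<phi>2)
  have 1: "suffix k w \<Turnstile> \<phi>1\<langle>C\<rangle>\<^sub>\<nu>" if "suffix k w \<Turnstile> \<phi>1" for k
    using Until.IH(1)[OF _ that] Until.prems(1) by simp
  have 2: "suffix k w \<Turnstile> \<phi>2\<langle>C\<rangle>\<^sub>\<nu>" if "suffix k w \<Turnstile> \<phi>2" for k
    using Until.IH(2)[OF _ that] Until.prems(1) by simp
  have "\<^bold>G (\<^bold>F \<phi>2) \<in> C"
    using Until.prems(2) Until.prems(1)[of \<phi>2] by auto
  then show ?case using 1 2 Until.prems(2) by simp blast
next
  case (StrongRelease \<phi>1 \<phi>2)
  have 1: "suffix k w \<Turnstile> \<phi>1\<langle>C\<rangle>\<^sub>\<nu>" if "suffix k w \<Turnstile> \<phi>1" for k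
    using StrongRelease.IH(1)[OF _ that] StrongRelease.prems(1) by simp
  have 2: "suffix k w \<Turnstile> \<phi>2\<langle>C\<rangle>\<^sub>\<nu>" if "suffix k w \<Turnstile> \<phi>2" for k
    using StrongRelease.IH(2)[OF _ that] StrongRelease.prems(1) by simp
  have "\<^bold>G (\<^bold>F \<phi>1) \<in> C"
    using StrongRelease.prems(2) StrongRelease.prems(1)[of \<phi>1] by auto
  then show ?case using 1 2 StrongRelease.prems(2) by simp blast
next
  case (WeakUntil \<phi>1 \<phi>2)
  have 1: "suffix k w \<Turnstile> \<phi>1\<langle>C\<rangle>\<^sub>\<nu>" if "suffix k w \<Turnstile> \<phi>1" for k
    using WeakUntil.IH(1)[OF _ that] WeakUntil.prems(1) by simp
  have 2: "suffix k w \<Turnstile> \<phi>2\<langle>C\<rangle>\<^sub>\<nu>" if "suffix k w \<Turnstile> \<phi>2" for k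
    using WeakUntil.IH(2)[OF _ that] WeakUntil.prems(1) by simp
  show ?case using 1 2 WeakUntil.prems(2) by simp blast
next
  case (Release \<phi>1 \<phi>2)
  have 1: "suffix k w \<Turnstile> \<phi>1\<langle>C\<rangle>\<^sub>\<nu>" if "suffix k w \<Turnstile> \<phi>1" for k
    using Release.IH(1)[OF _ that] Release.prems(1) by simp
  have 2: "suffix k w \<Turnstile> \<phi>2\<langle>C\<rangle>\<^sub>\<nu>" if "suffix k w \<Turnstile> \<phi>2" for k
    using Release.IH(2)[OF _ that] Release.prems(1) by simp
  show ?case using 1 2 Release.prems(2) by simp blast
qed auto

text \<open>The strong hypothesis of \<open>nu_complete\<close> need not hold on \<open>w\<close>
  itself, but it holds on late suffixes: the eventualities missing from \<open>C\<close> occur only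
  finitely often, and there are finitely many of them.\<close>

lemma MOST_nu_complete:
  assumes C: "\<And>\<psi>. \<psi> \<in> GF_args \<phi> \<Longrightarrow> \<exists>\<^sub>\<infinity>i. suffix i w \<Turnstile> \<psi> \<Longrightarrow> \<^bold>G (\<^bold>F \<psi>) \<in> C"
    and "\<forall>\<^sub>\<infinity>i. suffix i w \<Turnstile> \<phi>"
  shows "\<forall>\<^sub>\<infinity>i. suffix i w \<Turnstile> \<phi>\<langle>C\<rangle>\<^sub>\<nu>"
proof -
  \<comment> \<open>The eventualities left out of \<open>C\<close>; beyond a common bound
    \<open>m\<close> none of them holds any more.\<close>
  let ?A = "GF_args \<phi> - {\<psi>. \<^bold>G (\<^bold>F \<psi>) \<in> C}"
  have "\<forall>\<^sub>\<infinity>i. \<not> suffix i w \<Turnstile> \<psi>" if "\<psi> \<in> ?A" for \<psi>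
    using that C[of \<psi>] not_INFM[of "\<lambda>i. suffix i w \<Turnstile> \<psi>"] by blast
  then have "\<forall>\<^sub>\<infinity>i. \<forall>\<psi>\<in>?A. \<not> suffix i w \<Turnstile> \<psi>"
    by (intro eventually_ball_finite) simp_all
  with assms(2) have "\<forall>\<^sub>\<infinity>i. suffix i w \<Turnstile> \<phi> \<and> (\<forall>\<psi>\<in>?A. \<not> suffix i w \<Turnstile> \<psi>)"
    by (rule eventually_conj)
  then obtain m where m: "\<forall>i\<ge>m. suffix i w \<Turnstile> \<phi> \<and> (\<forall>\<psi>\<in>?A. \<not> suffix i w \<Turnstile> \<psi>)"
    unfolding MOST_nat_le by blast
  have "suffix i w \<Turnstile> \<phi>\<langle>C\<rangle>\<^sub>\<nu>" if "i \<ge> m" for i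
  proof (rule nu_complete)
    show "\<^bold>G (\<^bold>F \<psi>) \<in> C" if "\<psi> \<in> GF_args \<phi>" "suffix k (suffix i w) \<Turnstile> \<psi>" for \<psi> k
      using m[rule_format, of "i + k"] that \<open>i \<ge> m\<close> by auto
    show "suffix i w \<Turnstile> \<phi>"
      using m that by simp
  qed
  then show ?thesis unfolding MOST_nat_le by blast
qed

text \<open>If a weak until holds because its left argument holds forever, its FG formula is in
  \<open>C\<close> and the translation is true; otherwise it already holds as an until. Unlike for
  \<open>nu\<close>, this works at every position and not only at late ones.\<close>

lemma mu_complete:
  assumes "\<And>\<psi>. \<psi> \<in> FG_args \<phi> \<Longrightarrow> \<forall>\<^sub>\<infinity>i. suffix i w \<Turnstile> \<psi> \<Longrightarrow> \<^bold>F (\<^bold>G \<psi>) \<in> C"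
    and "suffix k w \<Turnstile> \<phi>"
  shows "suffix k w \<Turnstile> \<phi>\<langle>C\<rangle>\<^sub>\<mu>"
  using assms
proof (induction \<phi> arbitrary: k)
  case (Until \<phi>1 \<phi>2)
  have 1: "suffix k w \<Turnstile> \<phi>1\<langle>C\<rangle>\<^sub>\<mu>" if "suffix k w \<Turnstile> \<phi>1" for k
    using Until.IH(1)[OF _ that] Until.prems(1) by simp
  have 2: "suffix k w \<Turnstile> \<phi>2\<langle>C\<rangle>\<^sub>\<mu>" if "suffix k w \<Turnstile> \<phi>2" for k
    using Until.IH(2)[OF _ that] Until.prems(1) by simp
  show ?case using 1 2 Until.prems(2) by auto
next
  case (StrongRelease \<phi>1 \<phi>2)
  have 1: "suffix k w \<Turnstile> \<phi>1\<langle>C\<rangle>\<^sub>\<mu>" if "suffix k w \<Turnstile> \<phi>1" for k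
    using StrongRelease.IH(1)[OF _ that] StrongRelease.prems(1) by simp
  have 2: "suffix k w \<Turnstile> \<phi>2\<langle>C\<rangle>\<^sub>\<mu>" if "suffix k w \<Turnstile> \<phi>2" for k
    using StrongRelease.IH(2)[OF _ that] StrongRelease.prems(1) by simp
  show ?case using 1 2 StrongRelease.prems(2) by auto
next
  case (WeakUntil \<phi>1 \<phi>2)
  have 1: "suffix k w \<Turnstile> \<phi>1\<langle>C\<rangle>\<^sub>\<mu>" if "suffix k w \<Turnstile> \<phi>1" for k
    using WeakUntil.IH(1)[OF _ that] WeakUntil.prems(1) by simp
  have 2: "suffix k w \<Turnstile> \<phi>2\<langle>C\<rangle>\<^sub>\<mu>" if "suffix k w \<Turnstile> \<phi>2" for k
    using WeakUntil.IH(2)[OF _ that] WeakUntil.prems(1) by simp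
  have "\<^bold>F (\<^bold>G \<phi>1) \<in> C" if "\<forall>j. suffix (k + j) w \<Turnstile> \<phi>1"
    using WeakUntil.prems(1)[of \<phi>1] all_suffix_imp_MOST[OF that] by simp
  then show ?case using 1 2 WeakUntil.prems(2) by simp blast
next
  case (Release \<phi>1 \<phi>2)
  have 1: "suffix k w \<Turnstile> \<phi>1\<langle>C\<rangle>\<^sub>\<mu>" if "suffix k w \<Turnstile> \<phi>1" for k
    using Release.IH(1)[OF _ that] Release.prems(1) by simp
  have 2: "suffix k w \<Turnstile> \<phi>2\<langle>C\<rangle>\<^sub>\<mu>" if "suffix k w \<Turnstile> \<phi>2" for k
    using Release.IH(2)[OF _ that] Release.prems(1) by simp
  have "\<^bold>F (\<^bold>G \<phi>2) \<in> C" if "\<forall>j. suffix (k + j) w \<Turnstile> \<phi>2"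
    using Release.prems(1)[of \<phi>2] all_suffix_imp_MOST[OF that] by simp
  then show ?case using 1 2 Release.prems(2) by simp blast
qed auto

text \<open>If the left argument of a weak until holds forever, its \<open>nu\<close> translation
  eventually does too by \<open>MOST_nu_complete\<close>, which fulfils the added goal. If not, the
  weak until is an until and the original goal is reached. Release is treated alike with its right
  argument.\<close>

lemma sigma2_complete:
  assumes "\<And>\<psi>. \<psi> \<in> GF_args \<phi> \<Longrightarrow> \<exists>\<^sub>\<infinity>i. suffix i w \<Turnstile> \<psi> \<Longrightarrow> \<^bold>G (\<^bold>F \<psi>) \<in> C"
    and "suffix k w \<Turnstile> \<phi>"
  shows "suffix k w \<Turnstile> \<phi>\<langle>C\<rangle>\<^sub>\<Sigma>\<^sub>2"
  using assms
proof (induction \<phi> arbitrary: k)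
  case (Until \<phi>1 \<phi>2)
  have 1: "suffix k w \<Turnstile> \<phi>1\<langle>C\<rangle>\<^sub>\<Sigma>\<^sub>2" if "suffix k w \<Turnstile> \<phi>1" for k
    using Until.IH(1)[OF _ that] Until.prems(1) by simp
  have 2: "suffix k w \<Turnstile> \<phi>2\<langle>C\<rangle>\<^sub>\<Sigma>\<^sub>2" if "suffix k w \<Turnstile> \<phi>2" for k
    using Until.IH(2)[OF _ that] Until.prems(1) by simp
  show ?case using 1 2 Until.prems(2) by auto
next
  case (StrongRelease \<phi>1 \<phi>2)
  have 1: "suffix k w \<Turnstile> \<phi>1\<langle>C\<rangle>\<^sub>\<Sigma>\<^sub>2" if "suffix k w \<Turnstile> \<phi>1" for k
    using StrongRelease.IH(1)[OF _ that] StrongRelease.prems(1) by simp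
  have 2: "suffix k w \<Turnstile> \<phi>2\<langle>C\<rangle>\<^sub>\<Sigma>\<^sub>2" if "suffix k w \<Turnstile> \<phi>2" for k
    using StrongRelease.IH(2)[OF _ that] StrongRelease.prems(1) by simp
  show ?case using 1 2 StrongRelease.prems(2) by auto
next
  case (WeakUntil \<phi>1 \<phi>2)
  have 1: "suffix k w \<Turnstile> \<phi>1\<langle>C\<rangle>\<^sub>\<Sigma>\<^sub>2" if "suffix k w \<Turnstile> \<phi>1" for k
    using WeakUntil.IH(1)[OF _ that] WeakUntil.prems(1) by simp
  have 2: "suffix k w \<Turnstile> \<phi>2\<langle>C\<rangle>\<^sub>\<Sigma>\<^sub>2" if "suffix k w \<Turnstile> \<phi>2" for k
    using WeakUntil.IH(2)[OF _ that] WeakUntil.prems(1) by simp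
  show ?case
  proof (cases "\<forall>j. suffix (k + j) w \<Turnstile> \<phi>1")
    case True
    have "\<forall>\<^sub>\<infinity>i. suffix i w \<Turnstile> \<phi>1\<langle>C\<rangle>\<^sub>\<nu>"
      using all_suffix_imp_MOST[OF True] WeakUntil.prems(1)
      by (intro MOST_nu_complete) simp_all
    then obtain m where "\<forall>i\<ge>m. suffix i w \<Turnstile> \<phi>1\<langle>C\<rangle>\<^sub>\<nu>"
      unfolding MOST_nat_le by blast
    \<comment> \<open>The bound \<open>m\<close> counts from the start of the word; reused as an
      offset from \<open>k\<close> it gives position \<open>k + m\<close>, which is late
      enough.\<close>
    then have "\<forall>i. suffix (k + m + i) w \<Turnstile> \<phi>1\<langle>C\<rangle>\<^sub>\<nu>"
      by simp
    then show ?thesis using 1 True by auto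
  next
    case False
    then show ?thesis using 1 2 WeakUntil.prems(2) by simp blast
  qed
next
  case (Release \<phi>1 \<phi>2)
  have 1: "suffix k w \<Turnstile> \<phi>1\<langle>C\<rangle>\<^sub>\<Sigma>\<^sub>2" if "suffix k w \<Turnstile> \<phi>1" for k
    using Release.IH(1)[OF _ that] Release.prems(1) by simp
  have 2: "suffix k w \<Turnstile> \<phi>2\<langle>C\<rangle>\<^sub>\<Sigma>\<^sub>2" if "suffix k w \<Turnstile> \<phi>2" for k
    using Release.IH(2)[OF _ that] Release.prems(1) by simp
  show ?case
  proof (cases "\<forall>j. suffix (k + j) w \<Turnstile> \<phi>2")
    case True
    have "\<forall>\<^sub>\<infinity>i. suffix i w \<Turnstile> \<phi>2\<langle>C\<rangle>\<^sub>\<nu>"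
      using all_suffix_imp_MOST[OF True] Release.prems(1)
      by (intro MOST_nu_complete) simp_all
    then obtain m where "\<forall>i\<ge>m. suffix i w \<Turnstile> \<phi>2\<langle>C\<rangle>\<^sub>\<nu>"
      unfolding MOST_nat_le by blast
    then have "\<forall>i. suffix (k + m + i) w \<Turnstile> \<phi>2\<langle>C\<rangle>\<^sub>\<nu>"
      by simp
    then show ?thesis using 2 True by auto
  next
    case False
    then show ?thesis using 1 2 Release.prems(2) by simp blast
  qed
qed auto

section \<open>Certification of the guesses\<close>

text \<open>Both halves are proved together because each needs the other: \<open>mu_sound\<close>
  for a member of \<open>M\<close> asks about shorter members of \<open>N\<close>, while
  \<open>nu_sound\<close> for a member of \<open>N\<close> asks about shorter members of
  \<open>M\<close>.\<close>

lemma guess_sound: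
  assumes fin: "finite {\<psi>. \<^bold>F (\<^bold>G \<psi>) \<in> N}"
    and M: "\<And>\<psi>. \<^bold>G (\<^bold>F \<psi>) \<in> M \<Longrightarrow> \<exists>\<^sub>\<infinity>i. suffix i w \<Turnstile> \<psi>\<langle>N\<rangle>\<^sub>\<mu>"
    and N: "\<And>\<psi>. \<^bold>F (\<^bold>G \<psi>) \<in> N \<Longrightarrow> \<forall>\<^sub>\<infinity>i. suffix i w \<Turnstile> \<psi>\<langle>M\<rangle>\<^sub>\<nu>"
  shows "(\<^bold>G (\<^bold>F \<psi>) \<in> M \<longrightarrow> (\<exists>\<^sub>\<infinity>i. suffix i w \<Turnstile> \<psi>)) \<and>
         (\<^bold>F (\<^bold>G \<psi>) \<in> N \<longrightarrow> (\<forall>\<^sub>\<infinity>i. suffix i w \<Turnstile> \<psi>))"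
proof (induction \<psi> rule: measure_induct_rule[of len])
  case (less \<psi>)
  show ?case
  proof (intro conjI impI)
    assume "\<^bold>G (\<^bold>F \<psi>) \<in> M"
    \<comment> \<open>Each shorter member of \<open>N\<close> holds almost always by induction;
      finiteness of \<open>N\<close>'s indices gives one bound \<open>m\<close> beyond which all
      hold, as \<open>mu_sound\<close> requires on the suffix.\<close>
    have "\<forall>\<^sub>\<infinity>i. \<forall>\<chi>\<in>{\<chi> \<in> {\<chi>. \<^bold>F (\<^bold>G \<chi>) \<in> N}. len \<chi> < len \<psi>}. suffix i w \<Turnstile> \<chi>"
      using fin less.IH by (intro eventually_ball_finite) auto
    then obtain m
      where m: "\<And>i \<chi>. i \<ge> m \<Longrightarrow> \<^bold>F (\<^bold>G \<chi>) \<in> N \<Longrightarrow> len \<chi> < len \<psi> \<Longrightarrow> suffix i w \<Turnstile> \<chi>"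
      unfolding MOST_nat_le by blast
    have "suffix i w \<Turnstile> \<psi>" if "i \<ge> m" "suffix i w \<Turnstile> \<psi>\<langle>N\<rangle>\<^sub>\<mu>" for i
      using m that by (intro mu_sound[of N \<psi>]) auto
    then have "\<forall>\<^sub>\<infinity>i. suffix i w \<Turnstile> \<psi>\<langle>N\<rangle>\<^sub>\<mu> \<longrightarrow> suffix i w \<Turnstile> \<psi>"
      unfolding MOST_nat_le by blast
    with M[OF \<open>\<^bold>G (\<^bold>F \<psi>) \<in> M\<close>] show "\<exists>\<^sub>\<infinity>i. suffix i w \<Turnstile> \<psi>"
      by (rule frequently_rev_mp)
  next
    assume "\<^bold>F (\<^bold>G \<psi>) \<in> N"
    \<comment> \<open>No late suffix is needed here, since \<open>nu_sound\<close> asks only for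
      recurrence.\<close>
    have "suffix i w \<Turnstile> \<psi>" if "suffix i w \<Turnstile> \<psi>\<langle>M\<rangle>\<^sub>\<nu>" for i
      using nu_sound[OF _ that] less.IH by blast
    with N[OF \<open>\<^bold>F (\<^bold>G \<psi>) \<in> N\<close>] show "\<forall>\<^sub>\<infinity>i. suffix i w \<Turnstile> \<psi>"
      by (rule eventually_mono)
  qed
qed

section \<open>Semantics of the normal form\<close>

lemma enumeration:
  assumes "finite I"
  shows "set (enumeration I) = I \<and> distinct (enumeration I)"
  unfolding enumeration_def by (rule someI_ex) (use finite_distinct_list[OF assms] in blast)

lemma models_Conj:
  assumes "finite I"
  shows "w \<Turnstile> Conj I f \<longleftrightarrow> (\<forall>i\<in>I. w \<Turnstile> f i)"
proof -
  \<comment> \<open>Proved for arbitrary lists, since the order chosen by \<open>enumeration\<close>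
    is unknown and the induction runs over the list.\<close>
  have "w \<Turnstile> foldr (\<lambda>i \<phi>. f i \<^bold>\<and> \<phi>) xs \<^bold>t\<^bold>t \<longleftrightarrow> (\<forall>i\<in>set xs. w \<Turnstile> f i)" for xs
    by (induction xs) auto
  then show ?thesis using assms by (simp add: Conj_def enumeration)
qed

lemma models_Disj:
  assumes "finite I"
  shows "w \<Turnstile> Disj I f \<longleftrightarrow> (\<exists>i\<in>I. w \<Turnstile> f i)"
proof -
  have "w \<Turnstile> foldr (\<lambda>i \<phi>. f i \<^bold>\<or> \<phi>) xs \<^bold>f\<^bold>f \<longleftrightarrow> (\<exists>i\<in>set xs. w \<Turnstile> f i)" for xs
    by (induction xs) auto
  then show ?thesis using assms by (simp add: Disj_def enumeration)
qed

lemma FG_indices: "N \<subseteq> B_FG \<phi> \<Longrightarrow> {\<psi>. \<^bold>F (\<^bold>G \<psi>) \<in> N} \<subseteq> FG_args \<phi>"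
  unfolding B_FG_eq by auto

lemma GF_indices: "M \<subseteq> B_GF \<phi> \<Longrightarrow> {\<psi>. \<^bold>G (\<^bold>F \<psi>) \<in> M} \<subseteq> GF_args \<phi>"
  unfolding B_GF_eq by auto

lemma finite_FG_indices: "N \<subseteq> B_FG \<phi> \<Longrightarrow> finite {\<psi>. \<^bold>F (\<^bold>G \<psi>) \<in> N}"
  using FG_indices finite_FG_args by (rule finite_subset)

lemma finite_GF_indices: "M \<subseteq> B_GF \<phi> \<Longrightarrow> finite {\<psi>. \<^bold>G (\<^bold>F \<psi>) \<in> M}"
  using GF_indices finite_GF_args by (rule finite_subset)

lemma finite_disjuncts: "finite (Pow (B_GF \<phi>) \<times> Pow (B_FG \<phi>))"
  by (simp add: B_GF_eq B_FG_eq)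

text \<open>Removes the syntax of the big conjunctions and disjunction, leaving exactly the
  conditions that \<open>guess_sound\<close> and the completeness lemmas speak about.\<close>

lemma models_normal_form:
  "w \<Turnstile> normal_form \<phi> \<longleftrightarrow>
     (\<exists>M N. M \<subseteq> B_GF \<phi> \<and> N \<subseteq> B_FG \<phi> \<and> w \<Turnstile> \<phi>\<langle>M\<rangle>\<^sub>\<Sigma>\<^sub>2 \<and>
        (\<forall>\<psi>. \<^bold>F (\<^bold>G \<psi>) \<in> N \<longrightarrow> (\<forall>\<^sub>\<infinity>i. suffix i w \<Turnstile> \<psi>\<langle>M\<rangle>\<^sub>\<nu>)) \<and>
        (\<forall>\<psi>. \<^bold>G (\<^bold>F \<psi>) \<in> M \<longrightarrow> (\<exists>\<^sub>\<infinity>i. suffix i w \<Turnstile> \<psi>\<langle>N\<rangle>\<^sub>\<mu>)))"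
proof -
  have "w \<Turnstile> normal_form \<phi> \<longleftrightarrow>
     (\<exists>M N. M \<subseteq> B_GF \<phi> \<and> N \<subseteq> B_FG \<phi> \<and> w \<Turnstile> \<phi>\<langle>M\<rangle>\<^sub>\<Sigma>\<^sub>2 \<and>
        w \<Turnstile> Conj {\<psi>. \<^bold>F (\<^bold>G \<psi>) \<in> N} (\<lambda>\<psi>. \<^bold>F (\<^bold>G (\<psi>\<langle>M\<rangle>\<^sub>\<nu>))) \<and>
        w \<Turnstile> Conj {\<psi>. \<^bold>G (\<^bold>F \<psi>) \<in> M} (\<lambda>\<psi>. \<^bold>G (\<^bold>F (\<psi>\<langle>N\<rangle>\<^sub>\<mu>))))"
    unfolding normal_form_def models_Disj[OF finite_disjuncts] by auto
  then show ?thesis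
    \<comment> \<open>The unfolding of until and weak until is switched off so that
      \<open>models_FG\<close> and \<open>models_GF\<close> see their patterns;
      \<open>conj_cong\<close> makes the inclusions of \<open>M\<close> and \<open>N\<close>
      available for the finiteness conditions.\<close>
    by (simp add: models_Conj finite_FG_indices finite_GF_indices models_FG models_GF
        del: models.simps(8,9) cong: conj_cong)
qed

lemma normal_form_equiv: "w \<Turnstile> normal_form \<phi> \<longleftrightarrow> w \<Turnstile> \<phi>"
proof
  assume "w \<Turnstile> normal_form \<phi>"
  then obtain M N where N: "N \<subseteq> B_FG \<phi>" and \<phi>: "w \<Turnstile> \<phi>\<langle>M\<rangle>\<^sub>\<Sigma>\<^sub>2"
    and guess: "\<And>\<psi>. \<^bold>F (\<^bold>G \<psi>) \<in> N \<Longrightarrow> \<forall>\<^sub>\<infinity>i. suffix i w \<Turnstile> \<psi>\<langle>M\<rangle>\<^sub>\<nu>"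
      "\<And>\<psi>. \<^bold>G (\<^bold>F \<psi>) \<in> M \<Longrightarrow> \<exists>\<^sub>\<infinity>i. suffix i w \<Turnstile> \<psi>\<langle>N\<rangle>\<^sub>\<mu>"
    unfolding models_normal_form by blast
  \<comment> \<open>The certified \<open>M\<close> is precisely what \<open>sigma2_sound\<close>
    assumes; it is applied at position 0.\<close>
  from guess_sound[OF finite_FG_indices[OF N] guess(2,1)] show "w \<Turnstile> \<phi>"
    using sigma2_sound[of M w 0 \<phi>] \<phi> by simp
next
  assume w: "w \<Turnstile> \<phi>"
  \<comment> \<open>The exact guess: the members of the two bases that are true on
    \<open>w\<close>.\<close>
  define M where "M = (\<lambda>\<psi>. \<^bold>G (\<^bold>F \<psi>)) ` {\<psi> \<in> GF_args \<phi>. \<exists>\<^sub>\<infinity>i. suffix i w \<Turnstile> \<psi>}"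
  define N where "N = (\<lambda>\<psi>. \<^bold>F (\<^bold>G \<psi>)) ` {\<psi> \<in> FG_args \<phi>. \<forall>\<^sub>\<infinity>i. suffix i w \<Turnstile> \<psi>}"
  have M: "\<^bold>G (\<^bold>F \<psi>) \<in> M \<longleftrightarrow> \<psi> \<in> GF_args \<phi> \<and> (\<exists>\<^sub>\<infinity>i. suffix i w \<Turnstile> \<psi>)" for \<psi>
    by (auto simp: M_def)
  have N: "\<^bold>F (\<^bold>G \<psi>) \<in> N \<longleftrightarrow> \<psi> \<in> FG_args \<phi> \<and> (\<forall>\<^sub>\<infinity>i. suffix i w \<Turnstile> \<psi>)" for \<psi>
    by (auto simp: N_def)
  have "\<forall>\<^sub>\<infinity>i. suffix i w \<Turnstile> \<psi>\<langle>M\<rangle>\<^sub>\<nu>" if "\<^bold>F (\<^bold>G \<psi>) \<in> N" for \<psi>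
  proof (rule MOST_nu_complete)
    from that show "\<forall>\<^sub>\<infinity>i. suffix i w \<Turnstile> \<psi>" by (simp add: N)
    \<comment> \<open>As \<open>psi\<close> is a subformula, its eventualities are among those of
      the whole formula, so \<open>M\<close> is exact for them as well.\<close>
    have "\<psi> \<in> sf \<phi>" using that FG_args_subset_sf by (auto simp: N)
    then show "\<^bold>G (\<^bold>F \<chi>) \<in> M" if "\<chi> \<in> GF_args \<psi>" "\<exists>\<^sub>\<infinity>i. suffix i w \<Turnstile> \<chi>" for \<chi>
      using that GF_args_mono by (auto simp: M)
  qed
  moreover have "\<exists>\<^sub>\<infinity>i. suffix i w \<Turnstile> \<psi>\<langle>N\<rangle>\<^sub>\<mu>" if "\<^bold>G (\<^bold>F \<psi>) \<in> M" for \<psi>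
  proof -
    have "\<psi> \<in> sf \<phi>" using that GF_args_subset_sf by (auto simp: M)
    then have "suffix i w \<Turnstile> \<psi>\<langle>N\<rangle>\<^sub>\<mu>" if "suffix i w \<Turnstile> \<psi>" for i
      using FG_args_mono
      by (intro mu_complete[OF _ that]) (auto simp: N)
    then show ?thesis
      using that by (auto simp: M elim: frequently_elim1)
  qed
  moreover have "w \<Turnstile> \<phi>\<langle>M\<rangle>\<^sub>\<Sigma>\<^sub>2"
    using w sigma2_complete[of \<phi> w M 0] by (simp add: M)
  moreover have "M \<subseteq> B_GF \<phi>" "N \<subseteq> B_FG \<phi>"
    by (auto simp: M_def N_def B_GF_eq B_FG_eq)
  ultimately show "w \<Turnstile> normal_form \<phi>"
    unfolding models_normal_form by blast
qed

section \<open>Position in the hierarchy\<close>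

lemma basic_subset_Pi_1: "basic_formulas Ap \<subseteq> Pi_ltl Ap 1"
  by (auto intro: pi_closure.base)

lemma Pi_1_subset_Sigma_2: "Pi_ltl Ap 1 \<subseteq> Sigma_ltl Ap 2"
  by (auto simp: numeral_2_eq_2 intro: sigma_closure.base)

text \<open>Every until and strong release has become weak until, release or false, so no
  least-fixpoint operator is left. Dually for \<open>mu\<close>.\<close>

lemma nu_in_Pi_1: "atoms \<phi> \<subseteq> Ap \<Longrightarrow> \<phi>\<langle>C\<rangle>\<^sub>\<nu> \<in> Pi_ltl Ap 1"
  by (induction \<phi>) (auto intro: pi_closure.intros basic_formulas.intros)

lemma mu_in_Sigma_1: "atoms \<phi> \<subseteq> Ap \<Longrightarrow> \<phi>\<langle>C\<rangle>\<^sub>\<mu> \<in> Sigma_ltl Ap 1"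
  by (induction \<phi>) (auto intro: sigma_closure.intros basic_formulas.intros)

lemma Globally_nu_in_Pi_1: "atoms \<phi> \<subseteq> Ap \<Longrightarrow> \<^bold>G (\<phi>\<langle>C\<rangle>\<^sub>\<nu>) \<in> Pi_ltl Ap 1"
  using nu_in_Pi_1[of \<phi> Ap C] by (auto intro: pi_closure.intros basic_formulas.intros)

text \<open>The only greatest-fixpoint operators left lie inside globally-prefixed \<open>nu\<close>
  translations, which belong to the base set of the closure.\<close>

lemma sigma2_in_Sigma_2:
  assumes "atoms \<phi> \<subseteq> Ap"
  shows "\<phi>\<langle>C\<rangle>\<^sub>\<Sigma>\<^sub>2 \<in> Sigma_ltl Ap 2"
proof -
  have S: "Sigma_ltl Ap 2 = sigma_closure (Pi_ltl Ap 1)"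
    by (simp add: numeral_2_eq_2)
  have base: "\<chi> \<in> sigma_closure (Pi_ltl Ap 1)" if "\<chi> \<in> basic_formulas Ap" for \<chi>
    using that basic_subset_Pi_1 by (blast intro: sigma_closure.base)
  have G: "\<^bold>G (\<psi>\<langle>C\<rangle>\<^sub>\<nu>) \<in> sigma_closure (Pi_ltl Ap 1)" if "atoms \<psi> \<subseteq> Ap" for \<psi>
    using that by (intro sigma_closure.base Globally_nu_in_Pi_1)
  show ?thesis
    unfolding S using assms
    \<comment> \<open>\<open>Pi_ltl Ap 1\<close> must stay folded for \<open>G\<close> and
      \<open>base\<close> to match.\<close>
    by (induction \<phi>) (simp_all add: sigma_closure.intros(2-) G base basic_formulas.intros
      del: Pi_ltl.simps One_nat_def)
qed

lemma FG_nu_in_Sigma_2: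
  assumes "atoms \<phi> \<subseteq> Ap"
  shows "\<^bold>F (\<^bold>G (\<phi>\<langle>C\<rangle>\<^sub>\<nu>)) \<in> Sigma_ltl Ap 2"
proof -
  have "\<^bold>t\<^bold>t \<in> Sigma_ltl Ap 2" "\<^bold>G (\<phi>\<langle>C\<rangle>\<^sub>\<nu>) \<in> Sigma_ltl Ap 2"
    using basic_subset_Pi_1 Pi_1_subset_Sigma_2 Globally_nu_in_Pi_1[OF assms] basic_formulas.tt
    by blast+
  then show ?thesis
    unfolding numeral_2_eq_2 Sigma_ltl.simps(2) by (rule sigma_closure.until)
qed

lemma GF_mu_in_Pi_2:
  assumes "atoms \<phi> \<subseteq> Ap"
  shows "\<^bold>G (\<^bold>F (\<phi>\<langle>C\<rangle>\<^sub>\<mu>)) \<in> Pi_ltl Ap 2"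
proof -
  have "\<^bold>F (\<phi>\<langle>C\<rangle>\<^sub>\<mu>) \<in> Sigma_ltl Ap 1" "\<^bold>f\<^bold>f \<in> Sigma_ltl Ap 1"
    using mu_in_Sigma_1[OF assms, of C] by (auto intro: sigma_closure.intros basic_formulas.intros)
  then show ?thesis
    by (simp add: numeral_2_eq_2 pi_closure.weak_until pi_closure.base)
qed

lemma Conj_in_boolean_closure:
  assumes "finite I" "\<And>i. i \<in> I \<Longrightarrow> f i \<in> boolean_closure S" "\<^bold>t\<^bold>t \<in> boolean_closure S"
  shows "Conj I f \<in> boolean_closure S"
proof -
  have "foldr (\<lambda>i \<phi>. f i \<^bold>\<and> \<phi>) xs \<^bold>t\<^bold>t \<in> boolean_closure S" if "set xs \<subseteq> I" for xs
    using that assms by (induction xs) (auto intro: boolean_closure.conj)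
  then show ?thesis using assms(1) by (simp add: Conj_def enumeration)
qed

lemma Disj_in_boolean_closure:
  assumes "finite I" "\<And>i. i \<in> I \<Longrightarrow> f i \<in> boolean_closure S" "\<^bold>f\<^bold>f \<in> boolean_closure S"
  shows "Disj I f \<in> boolean_closure S"
proof -
  have "foldr (\<lambda>i \<phi>. f i \<^bold>\<or> \<phi>) xs \<^bold>f\<^bold>f \<in> boolean_closure S" if "set xs \<subseteq> I" for xs
    using that assms by (induction xs) (auto intro: boolean_closure.disj)
  then show ?thesis using assms(1) by (simp add: Disj_def enumeration)
qed

lemma atoms_sf: "\<psi> \<in> sf \<phi> \<Longrightarrow> atoms \<psi> \<subseteq> atoms \<phi>"
  by (induction \<phi>) auto

lemma normal_form_in_Delta_2:
  assumes "atoms \<phi> \<subseteq> Ap"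
  shows "normal_form \<phi> \<in> Delta_ltl Ap 2"
proof -
  let ?D = "boolean_closure (Sigma_ltl Ap 2 \<union> Pi_ltl Ap 2)"
  have base: "\<chi> \<in> ?D" if "\<chi> \<in> Sigma_ltl Ap 2 \<or> \<chi> \<in> Pi_ltl Ap 2" for \<chi>
    using that by (blast intro: boolean_closure.base)
  \<comment> \<open>The neutral elements that end the chains of \<open>Conj\<close> and
    \<open>Disj\<close>.\<close>
  have const: "\<^bold>t\<^bold>t \<in> ?D" "\<^bold>f\<^bold>f \<in> ?D"
    using basic_subset_Pi_1 Pi_1_subset_Sigma_2 by (blast intro: base basic_formulas.intros)+
  have sub: "atoms \<psi> \<subseteq> Ap" if "\<psi> \<in> sf \<phi>" for \<psi>
    using atoms_sf[OF that] assms by blast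
  have "\<phi>\<langle>M\<rangle>\<^sub>\<Sigma>\<^sub>2
       \<^bold>\<and> Conj {\<psi>. \<^bold>F (\<^bold>G \<psi>) \<in> N} (\<lambda>\<psi>. \<^bold>F (\<^bold>G (\<psi>\<langle>M\<rangle>\<^sub>\<nu>)))
       \<^bold>\<and> Conj {\<psi>. \<^bold>G (\<^bold>F \<psi>) \<in> M} (\<lambda>\<psi>. \<^bold>G (\<^bold>F (\<psi>\<langle>N\<rangle>\<^sub>\<mu>))) \<in> ?D"
    if MN: "M \<subseteq> B_GF \<phi>" "N \<subseteq> B_FG \<phi>" for M N
  proof (intro boolean_closure.conj Conj_in_boolean_closure const
      finite_FG_indices[OF MN(2)] finite_GF_indices[OF MN(1)])
    show "\<phi>\<langle>M\<rangle>\<^sub>\<Sigma>\<^sub>2 \<in> ?D"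
      using sigma2_in_Sigma_2[OF assms] by (blast intro: base)
    show "\<^bold>F (\<^bold>G (\<psi>\<langle>M\<rangle>\<^sub>\<nu>)) \<in> ?D" if "\<psi> \<in> {\<psi>. \<^bold>F (\<^bold>G \<psi>) \<in> N}" for \<psi>
      using that FG_indices[OF MN(2)] FG_args_subset_sf
      by (intro base disjI1 FG_nu_in_Sigma_2 sub) blast
    show "\<^bold>G (\<^bold>F (\<psi>\<langle>N\<rangle>\<^sub>\<mu>)) \<in> ?D" if "\<psi> \<in> {\<psi>. \<^bold>G (\<^bold>F \<psi>) \<in> M}" for \<psi>
      using that GF_indices[OF MN(1)] GF_args_subset_sf
      by (intro base disjI2 GF_mu_in_Pi_2 sub) blast
  qed
  then have "normal_form \<phi> \<in> ?D"
    unfolding normal_form_def using finite_disjuncts const(2)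
    by (intro Disj_in_boolean_closure) auto
  then show ?thesis by (simp add: numeral_2_eq_2)
qed

section \<open>Length\<close>

lemma len_pos: "len \<phi> \<ge> 1"
  by (cases \<phi>) auto

lemma len_nu: "len (\<phi>\<langle>C\<rangle>\<^sub>\<nu>) \<le> len \<phi>"
  by (induction \<phi>) auto

lemma len_mu: "len (\<phi>\<langle>C\<rangle>\<^sub>\<mu>) \<le> len \<phi>"
  by (induction \<phi>) auto

text \<open>Each weak until or release adds one \<open>nu\<close> copy of an original argument. Such
  copies have at most the argument's length and are not translated again, so the growth is quadratic
  rather than exponential.\<close>

lemma len_sigma2: "len (\<phi>\<langle>C\<rangle>\<^sub>\<Sigma>\<^sub>2) \<le> 4 * (len \<phi>)\<^sup>2"
proof (induction \<phi>)
  case (WeakUntil \<phi>1 \<phi>2)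
  then show ?case
    using len_nu[of \<phi>1 C] by (simp add: power2_eq_square algebra_simps)
next
  case (Release \<phi>1 \<phi>2)
  then show ?case
    using len_nu[of \<phi>2 C] by (simp add: power2_eq_square algebra_simps)
qed (simp_all add: power2_eq_square algebra_simps)

text \<open>Each operand costs its own length and one connective; the last summand is the neutral
  element.\<close>

lemma len_Conj:
  assumes "finite I" "\<And>i. i \<in> I \<Longrightarrow> len (f i) \<le> b"
  shows "len (Conj I f) \<le> card I * (b + 1) + 1"
proof -
  have "len (foldr (\<lambda>i \<phi>. f i \<^bold>\<and> \<phi>) xs \<^bold>t\<^bold>t) \<le> length xs * (b + 1) + 1" if "set xs \<subseteq> I" for xs
    using that by (induction xs) (auto dest: assms(2))
  from this[of "enumeration I"] show ?thesis
    using enumeration[OF assms(1)] distinct_card[of "enumeration I"] by (simp add: Conj_def)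
qed

lemma len_Disj:
  assumes "finite I" "\<And>i. i \<in> I \<Longrightarrow> len (f i) \<le> b"
  shows "len (Disj I f) \<le> card I * (b + 1) + 1"
proof -
  have "len (foldr (\<lambda>i \<phi>. f i \<^bold>\<or> \<phi>) xs \<^bold>f\<^bold>f) \<le> length xs * (b + 1) + 1" if "set xs \<subseteq> I" for xs
    using that by (induction xs) (auto dest: assms(2))
  from this[of "enumeration I"] show ?thesis
    using enumeration[OF assms(1)] distinct_card[of "enumeration I"] by (simp add: Disj_def)
qed

section \<open>Number of subformulas and of disjuncts\<close>

lemma len_sf: "\<psi> \<in> sf \<phi> \<Longrightarrow> len \<psi> \<le> len \<phi>"
  by (induction \<phi>) auto

lemma card_sf: "card (sf \<phi>) \<le> len \<phi>"
proof -
  have *: "card (insert x (A \<union> B)) \<le> m + n + 1"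
    if "card A \<le> m" "card B \<le> n" for x :: "'a ltl" and A B m n
    using that card_Un_le[of A B] card_insert_le_m1[of "m + n + 1" "A \<union> B" x] by simp
  show ?thesis
  proof (induction \<phi>)
    case (Next \<phi>)
    then show ?case by (simp add: card_insert_if)
  \<comment> \<open>The bound is rewritten to the \<open>Suc\<close> form into which simp brings the
    goals.\<close>
  qed (simp_all add: *[unfolded Suc_eq_plus1[symmetric]])
qed

lemma card_GF_args: "card (GF_args \<phi>) \<le> len \<phi>"
  using card_mono[OF finite_sf GF_args_subset_sf] card_sf by (rule order_trans)

lemma card_FG_args: "card (FG_args \<phi>) \<le> len \<phi>"
  using card_mono[OF finite_sf FG_args_subset_sf] card_sf by (rule order_trans)

lemma card_disjuncts: "card (Pow (B_GF \<phi>) \<times> Pow (B_FG \<phi>)) \<le> 4 ^ len \<phi>"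
proof -
  have "card (B_GF \<phi>) \<le> len \<phi>" "card (B_FG \<phi>) \<le> len \<phi>"
    unfolding B_GF_eq B_FG_eq
    by (rule order_trans[OF card_image_le[OF finite_GF_args] card_GF_args]
        order_trans[OF card_image_le[OF finite_FG_args] card_FG_args])+
  then have "(2::nat) ^ card (B_GF \<phi>) * 2 ^ card (B_FG \<phi>) \<le> 2 ^ len \<phi> * 2 ^ len \<phi>"
    by (intro mult_mono power_increasing) auto
  also have "\<dots> = 4 ^ len \<phi>"
    by (simp flip: power_mult_distrib)
  finally show ?thesis
    by (simp add: card_cartesian_product card_Pow B_GF_eq B_FG_eq)
qed

lemma len_normal_form: "len (normal_form \<phi>) \<le> 2 ^ (10 * len \<phi>)"
proof -
  define n where "n = len \<phi>"
  have n: "n \<ge> 1" unfolding n_def by (rule len_pos)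
  \<comment> \<open>The parts add up to at most \<open>6 * n^2 + 10 * n + 4\<close>, which is below
    \<open>20 * n^2\<close> because \<open>n\<close> is at least 1.\<close>
  have disjunct: "len (\<phi>\<langle>M\<rangle>\<^sub>\<Sigma>\<^sub>2
       \<^bold>\<and> Conj {\<psi>. \<^bold>F (\<^bold>G \<psi>) \<in> N} (\<lambda>\<psi>. \<^bold>F (\<^bold>G (\<psi>\<langle>M\<rangle>\<^sub>\<nu>)))
       \<^bold>\<and> Conj {\<psi>. \<^bold>G (\<^bold>F \<psi>) \<in> M} (\<lambda>\<psi>. \<^bold>G (\<^bold>F (\<psi>\<langle>N\<rangle>\<^sub>\<mu>)))) \<le> 20 * n\<^sup>2"
    if "M \<subseteq> B_GF \<phi>" "N \<subseteq> B_FG \<phi>" for M N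
  proof -
    let ?N = "{\<psi>. \<^bold>F (\<^bold>G \<psi>) \<in> N}" and ?M = "{\<psi>. \<^bold>G (\<^bold>F \<psi>) \<in> M}"
    \<comment> \<open>The 4 counts the two operators of an FG prefix together with their constants
      true and false.\<close>
    have "len (Conj ?N (\<lambda>\<psi>. \<^bold>F (\<^bold>G (\<psi>\<langle>M\<rangle>\<^sub>\<nu>)))) \<le> card ?N * (n + 4 + 1) + 1"
    proof (rule len_Conj)
      show "finite ?N" using that(2) by (rule finite_FG_indices)
      fix \<psi> assume "\<psi> \<in> ?N"
      then have "len \<psi> \<le> n"
        unfolding n_def using FG_indices[OF that(2)] FG_args_subset_sf by (intro len_sf) blast
      then show "len (\<^bold>F (\<^bold>G (\<psi>\<langle>M\<rangle>\<^sub>\<nu>))) \<le> n + 4" using len_nu[of \<psi> M] by simp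
    qed
    moreover have "card ?N \<le> n"
      using card_mono[OF finite_FG_args FG_indices[OF that(2)]] card_FG_args[of \<phi>] n_def by simp
    ultimately have 1: "len (Conj ?N (\<lambda>\<psi>. \<^bold>F (\<^bold>G (\<psi>\<langle>M\<rangle>\<^sub>\<nu>)))) \<le> n * (n + 4 + 1) + 1"
      using mult_le_mono1[of "card ?N" n "n + 4 + 1"] by linarith
    have "len (Conj ?M (\<lambda>\<psi>. \<^bold>G (\<^bold>F (\<psi>\<langle>N\<rangle>\<^sub>\<mu>)))) \<le> card ?M * (n + 4 + 1) + 1"
    proof (rule len_Conj)
      show "finite ?M" using that(1) by (rule finite_GF_indices)
      fix \<psi> assume "\<psi> \<in> ?M"
      then have "len \<psi> \<le> n"
        unfolding n_def using GF_indices[OF that(1)] GF_args_subset_sf by (intro len_sf) blast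
      then show "len (\<^bold>G (\<^bold>F (\<psi>\<langle>N\<rangle>\<^sub>\<mu>))) \<le> n + 4" using len_mu[of \<psi> N] by simp
    qed
    moreover have "card ?M \<le> n"
      using card_mono[OF finite_GF_args GF_indices[OF that(1)]] card_GF_args[of \<phi>] n_def by simp
    ultimately have 2: "len (Conj ?M (\<lambda>\<psi>. \<^bold>G (\<^bold>F (\<psi>\<langle>N\<rangle>\<^sub>\<mu>)))) \<le> n * (n + 4 + 1) + 1"
      using mult_le_mono1[of "card ?M" n "n + 4 + 1"] by linarith
    have "n \<le> n\<^sup>2" "1 \<le> n\<^sup>2" using n by (simp_all add: power2_eq_square)
    moreover have "n * (n + 4 + 1) = n\<^sup>2 + 5 * n" by (simp add: power2_eq_square algebra_simps)
    ultimately show ?thesis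
      using 1 2 len_sigma2[of \<phi> M, folded n_def] unfolding len.simps by linarith
  qed
  have "len (normal_form \<phi>) \<le> card (Pow (B_GF \<phi>) \<times> Pow (B_FG \<phi>)) * (20 * n\<^sup>2 + 1) + 1"
    unfolding normal_form_def using disjunct by (intro len_Disj finite_disjuncts) auto
  also have "\<dots> \<le> 4 ^ n * (20 * n\<^sup>2 + 1) + 1"
    using card_disjuncts[of \<phi>] unfolding n_def by (intro add_mono mult_le_mono1) auto
  also have "\<dots> \<le> 4 ^ n * (20 * n\<^sup>2 + 2)"
    by simp
  \<comment> \<open>Squaring \<open>n <= 2 ^ n\<close> bounds the polynomial factor by an
    exponential one; 32 is a convenient power of two above 22.\<close>
  also have "\<dots> \<le> 4 ^ n * (32 * 4 ^ n)"
  proof (rule mult_le_mono2)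
    have "n\<^sup>2 \<le> (2 ^ n)\<^sup>2" by (intro power_mono) auto
    also have "\<dots> = 4 ^ n" by (simp add: power2_eq_square flip: power_mult_distrib)
    finally show "20 * n\<^sup>2 + 2 \<le> 32 * 4 ^ n"
      using one_le_power[of "4::nat" n] by linarith
  qed
  also have "\<dots> = 2 ^ (4 * n + 5)"
  proof -
    have "(4::nat) ^ n = 2 ^ (2 * n)" by (simp add: power_mult)
    moreover have "4 * n + 5 = 2 * n + (5 + 2 * n)" by simp
    ultimately show ?thesis by (simp only: power_add) simp
  qed
  \<comment> \<open>\<open>4 * n + 5 <= 10 * n\<close> since \<open>n\<close> is at least 1.\<close>
  also have "\<dots> \<le> 2 ^ (10 * n)"
    using n by (intro power_increasing) auto
  finally show ?thesis unfolding n_def .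
qed

text \<open>The bound \<open>2^O(n)\<close> is expressed by a single exponent function
  \<open>f\<close> fixed before \<open>Ap\<close> and the formula, so its constant depends on
  neither; the witness is \<open>10 * n\<close>.\<close>

theorem theorem4p22:
  "(\<forall>(Ap :: 'a set) \<phi>. finite Ap \<longrightarrow> \<phi> \<in> formulas_over Ap \<longrightarrow>
      ltl_equiv Ap \<phi> (normal_form \<phi>) \<and> normal_form \<phi> \<in> Delta_ltl Ap 2)
   \<and> (\<exists>f :: nat \<Rightarrow> real. f \<in> O(\<lambda>n. real n) \<and>
        (\<forall>(Ap :: 'a set) \<phi>. finite Ap \<longrightarrow> \<phi> \<in> formulas_over Ap \<longrightarrow>
           real (len (normal_form \<phi>)) \<le> 2 powr f (len \<phi>)))"
proof (intro conjI exI[of _ "\<lambda>n. 10 * real n"] allI impI)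
  fix Ap :: "'a set" and \<phi> assume "\<phi> \<in> formulas_over Ap"
  then show "ltl_equiv Ap \<phi> (normal_form \<phi>)" "normal_form \<phi> \<in> Delta_ltl Ap 2"
    by (simp_all add: ltl_equiv_def normal_form_equiv normal_form_in_Delta_2 formulas_over_def)
next
  show "(\<lambda>n. 10 * real n) \<in> O(\<lambda>n. real n)" by simp
next
  fix \<phi> :: "'a ltl"
  have "real (len (normal_form \<phi>)) \<le> real (2 ^ (10 * len \<phi>))"
    using len_normal_form by (rule of_nat_mono)
  also have "\<dots> = 2 powr (10 * real (len \<phi>))"
    using powr_realpow[of 2 "10 * len \<phi>"] by simp
  finally show "real (len (normal_form \<phi>)) \<le> 2 powr (10 * real (len \<phi>))" .
qed

end
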